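(* Let $\lambda=(\lambda_1,\ldots,\lambda_n)$ be a partition, and for $p\in\mathbb{Z}$ let $p\lambda:=(p,\lambda_1,\ldots,\lambda_n)$. Then, as an identity of formal series in $z,z^{-1}$ with coefficients in $\Gamma$ (compared coefficient by coefficient), $$\sum_{p\in\mathbb{Z}}Q_{p\lambda}\,z^p=\kappa_z\cdot \kappa_{-1/z}^\perp\, Q_\lambda .$$
   Context: Let $x_1,x_2,\ldots$ be variables and define symmetric functions $q_n$ ($n\in\mathbb{Z}$) by $\kappa_z:=\prod_{i\ge1}\frac{1+zx_i}{1-zx_i}=\sum_{n\in\mathbb{Z}}q_nz^n$; so $q_0=1$ and $q_n=0$ for $n<0$. For $r,s\in\mathbb{Z}$ put $Q_{(r,s)}:=q_rq_s+2\sum_{i=1}^s(-1)^iq_{r+i}q_{s-i}$ (the sum is empty if $s<1$). A composition is a finite sequence of integers; a partition is a weakly decreasing composition with nonnegative parts; a composition is strict if its nonzero parts are distinct; $\ell(\lambda)$ is the number of nonzero parts. For a composition $\nu=(\nu_1,\ldots,\nu_N)$ let $M(\nu)$ be the $N\times N$ skew-symmetric matrix with $ij$-entry $Q_{(\nu_i,\nu_j)}$ if $i<j$, $0$ if $i=j$, and $-Q_{(\nu_j,\nu_i)}$ if $i>j$. For $\lambda\in\mathbb{Z}^n$ put $\lambda0:=(\lambda_1,\ldots,\lambda_n,0)$ and define $Q_\lambda:=\operatorname{Pf}M(\lambda)$ if $n$ is even and $Q_\lambda:=\operatorname{Pf}M(\lambda0)$ if $n$ is odd. Here $\operatorname{Pf}$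 is the Pfaffian, normalized by $\operatorname{Pf}M=\sum_{j=2}^{2N}(-1)^jm_{1j}\operatorname{Pf}M_{1j}$, where $M_{1j}$ is $M$ with rows and columns $1,j$ deleted; the empty Pfaffian is $1$. Let $\Gamma:=\mathbb{Z}[q_1,q_2,\ldots]$ (a subring of the ring of symmetric functions). The $Q_\lambda$, over strict partitions $\lambda$ (identified up to trailing zeros), form a $\mathbb{Z}$-basis of $\Gamma$; define an inner product on $\Gamma$ by $(Q_\lambda,Q_\mu)=2^{\ell(\lambda)}\delta_{\lambda\mu}$ for strict partitions $\lambda,\mu$. For $F\in\Gamma$, $F^\perp$ denotes the adjoint of multiplication by $F$ with respect to this inner product: $(FG,H)=(G,F^\perp H)$. For a series $F=\sum_nF_nz^n$ put $F^\perp:=\sum_nz^nF_n^\perp$; thus $\kappa_{-1/z}^\perp=\sum_{n\ge0}(-1)^nz^{-n}q_n^\perp$, and only finitely many of its terms act nontrivially on a given element of $\Gamma$. *)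

theory Defs
  imports
    Complex_Main
    "HOL-Library.FuncSet"
    "HOL-Computational_Algebra.Formal_Power_Series"
    "HOL-Library.Poly_Mapping"
    "HOL-Library.Groups_Big_Fun"
    "Jordan_Normal_Form.Determinant"
begin

section \<open>Formal power series over the integers in countably many variables\<close>

text \<open>A monomial is an exponent vector with finite support; a series is an arbitrary function
  from monomials to coefficients. The variables are indexed from 0.\<close>

type_synonym monomial = "nat \<Rightarrow>\<^sub>0 nat"

typedef ipser = "UNIV :: (monomial \<Rightarrow> int) set"
  morphisms icoeff Abs_ipser ..

setup_lifting type_definition_ipser

lemma ipser_eq_iff: "f = g \<longleftrightarrow> (\<forall>m. icoeff f m = icoeff g m)"
  by (simp add: icoeff_inject[symmetric] fun_eq_iff)

lemma finite_below_monomial: "finite {a :: monomial. \<exists>b. a + b = m}"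
proof (rule finite_imageD)
  let ?A = "{a :: monomial. \<exists>b. a + b = m}"
  let ?r = "\<lambda>a. restrict (Poly_Mapping.lookup a) (Poly_Mapping.keys m)"
  have zero: "Poly_Mapping.lookup a i = 0" if "a + b = m" "i \<notin> Poly_Mapping.keys m" for a b :: monomial and i
    using that by (metis add_is_0 in_keys_iff lookup_add)
  have le: "Poly_Mapping.lookup a i \<le> Poly_Mapping.lookup m i" if "a + b = m" for a b :: monomial and i
    using that by (metis le_add1 lookup_add)
  have "?r ` ?A \<subseteq> PiE (Poly_Mapping.keys m) (\<lambda>i. {..Poly_Mapping.lookup m i})"
    using le by auto
  then show "finite (?r ` ?A)"
    by (rule finite_subset) (auto intro: finite_PiE)
  show "inj_on ?r ?A"
  proof (rule inj_onI)
    fix a b assume a: "a \<in> ?A" and b: "b \<in> ?A" and eq: "?r a = ?r b"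
    have "Poly_Mapping.lookup a i = Poly_Mapping.lookup b i" for i
    proof (cases "i \<in> Poly_Mapping.keys m")
      case True
      then show ?thesis using fun_cong[OF eq, of i] by simp
    next
      case False
      then show ?thesis using a b zero by fastforce
    qed
    then show "a = b" by (intro poly_mapping_eqI)
  qed
qed

lemma finite_monomial_splits [simp]: "finite {(a, b). a + b = (m :: monomial)}"
proof (rule finite_subset)
  let ?A = "{a :: monomial. \<exists>b. a + b = m}"
  show "{(a, b). a + b = m} \<subseteq> (\<lambda>a. (a, m - a)) ` ?A"
    by (auto simp: image_iff)
  show "finite ((\<lambda>a. (a, m - a)) ` ?A)"
    using finite_below_monomial by blast
qed

lemma finite_monomial_splits' [simp]: "finite {p. fst p + snd p = (m :: monomial)}"
  using finite_monomial_splits[of m] by (simp add: case_prod_unfold)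

instantiation ipser :: comm_ring_1
begin

lift_definition zero_ipser :: ipser is "\<lambda>_. 0" .
lift_definition one_ipser :: ipser is "\<lambda>m. if m = 0 then 1 else 0" .
lift_definition plus_ipser :: "ipser \<Rightarrow> ipser \<Rightarrow> ipser" is "\<lambda>f g m. f m + g m" .
lift_definition minus_ipser :: "ipser \<Rightarrow> ipser \<Rightarrow> ipser" is "\<lambda>f g m. f m - g m" .
lift_definition uminus_ipser :: "ipser \<Rightarrow> ipser" is "\<lambda>f m. - f m" .
lift_definition times_ipser :: "ipser \<Rightarrow> ipser \<Rightarrow> ipser" is
  "\<lambda>f g m. \<Sum>(a, b) \<in> {(a, b). a + b = m}. f a * g b" .

instance
proof
  fix f g h :: ipser
  show "f * g * h = f * (g * h)"
  proof (transfer, rule ext)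
    fix f g h :: "monomial \<Rightarrow> int" and m :: monomial
    let ?S = "\<lambda>m :: monomial. {(a, b). a + b = m}"
    have "(\<Sum>(x, c) \<in> ?S m. (\<Sum>(a, b) \<in> ?S x. f a * g b) * h c)
      = (\<Sum>(x, c) \<in> ?S m. \<Sum>(a, b) \<in> ?S x. f a * g b * h c)"
      by (simp add: sum_distrib_right case_prod_unfold)
    also have "\<dots> = (\<Sum>((x, c), (a, b)) \<in> Sigma (?S m) (\<lambda>(x, c). ?S x). f a * g b * h c)"
      by (subst sum.Sigma[symmetric]) (auto simp: case_prod_unfold)
    also have "\<dots> = (\<Sum>((a, y), (b, c)) \<in> Sigma (?S m) (\<lambda>(a, y). ?S y). f a * g b * h c)"
      by (rule sum.reindex_bij_witness[of _
            "\<lambda>((a, y), (b, c)). ((a + b, c), (a, b))"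
            "\<lambda>((x, c), (a, b)). ((a, b + c), (b, c))"])
         (auto simp: add.assoc)
    also have "\<dots> = (\<Sum>(a, y) \<in> ?S m. \<Sum>(b, c) \<in> ?S y. f a * g b * h c)"
      by (subst sum.Sigma[symmetric]) (auto simp: case_prod_unfold)
    also have "\<dots> = (\<Sum>(a, y) \<in> ?S m. f a * (\<Sum>(b, c) \<in> ?S y. g b * h c))"
      by (simp add: sum_distrib_left case_prod_unfold mult.assoc)
    finally show "(\<Sum>(x, c) \<in> ?S m. (\<Sum>(a, b) \<in> ?S x. f a * g b) * h c)
      = (\<Sum>(a, y) \<in> ?S m. f a * (\<Sum>(b, c) \<in> ?S y. g b * h c))" .
  qed
  show "f * g = g * f"
    by (transfer, rule ext,
        rule sum.reindex_bij_witness[of _ "\<lambda>(a, b). (b, a)" "\<lambda>(a, b). (b, a)"])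
       (auto simp: add.commute mult.commute)
  show "1 * f = f"
  proof (transfer, rule ext)
    fix f :: "monomial \<Rightarrow> int" and m :: monomial
    have "(\<Sum>(a, b) \<in> {(a, b). a + b = m}. (if a = 0 then 1 else 0) * f b)
      = (\<Sum>(a, b) \<in> {(0 :: monomial, m)}. (if a = 0 then 1 else 0) * f b)"
      by (rule sum.mono_neutral_right) (auto split: if_splits)
    then show "(\<Sum>(a, b) \<in> {(a, b). a + b = m}. (if a = 0 then 1 else 0) * f b) = f m"
      by simp
  qed
  show "(f + g) * h = f * h + g * h"
    by transfer (simp add: case_prod_unfold ring_distribs sum.distrib)
  show "f + g + h = f + (g + h)" "f + g = g + f" "0 + f = f" "- f + f = 0" "f - g = f + - g"
    by (transfer; simp add: algebra_simps fun_eq_iff)+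
  show "(0 :: ipser) \<noteq> 1"
    by transfer (auto simp: fun_eq_iff)
qed

end

lift_definition xvar :: "nat \<Rightarrow> ipser" is
  "\<lambda>i m. if m = Poly_Mapping.single i 1 then 1 else 0" .


section \<open>The symmetric functions \<open>q\<^sub>n\<close>\<close>

text \<open>The indeterminate \<open>z\<close> is \<^const>\<open>fps_X\<close>.\<close>

definition kappa_factor :: "nat \<Rightarrow> ipser fps" where
  "kappa_factor i = (1 + fps_const (xvar i) * fps_X) * Abs_fps (\<lambda>n. xvar i ^ n)"

lemma geometric_series_inverse:
  "(1 - fps_const (xvar i) * fps_X) * Abs_fps (\<lambda>n. xvar i ^ n) = 1"
proof (rule fps_ext)
  fix n
  show "fps_nth ((1 - fps_const (xvar i) * fps_X) * Abs_fps (\<lambda>n. xvar i ^ n)) n = fps_nth 1 n"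
    by (cases n) (simp_all add: left_diff_distrib mult.assoc)
qed

lemma kappa_factor_mult: "kappa_factor i * (1 - fps_const (xvar i) * fps_X)
    = 1 + fps_const (xvar i) * fps_X"
  unfolding kappa_factor_def mult.assoc
  by (subst mult.commute[of "Abs_fps _"]) (simp only: geometric_series_inverse mult_1_right)

text \<open>The infinite product is taken coefficientwise; by \<open>kappa_partial_products\<close> below every
  coefficient of the partial products is eventually constant, so that \<^const>\<open>lim\<close> is a genuine
  limit.\<close>

definition kappa :: "ipser fps" where
  "kappa = Abs_fps (\<lambda>n. Abs_ipser (\<lambda>m. 
     lim (\<lambda>N. icoeff (fps_nth (\<Prod>i<N. kappa_factor i) n) m)))"

definition q :: "int \<Rightarrow> ipser" where
  "q n = (if n < 0 then 0 else fps_nth kappa (nat n))"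

lemma icoeff_mult_xvar_eq_0:
  assumes "Poly_Mapping.lookup m i = 0"
  shows "icoeff (f * xvar i) m = 0"
proof -
  have "a + Poly_Mapping.single i 1 \<noteq> m" for a
    using assms by (metis add_is_0 lookup_add lookup_single_eq one_neq_zero)
  then have "icoeff f a * icoeff (xvar i) b = 0" if "a + b = m" for a b
    using that by (cases "b = Poly_Mapping.single i 1") (simp_all add: xvar.rep_eq)
  then have "(case p of (a, b) \<Rightarrow> icoeff f a * icoeff (xvar i) b) = 0"
    if "p \<in> {(a, b). a + b = m}" for p
    using that by (simp only: mem_Collect_eq case_prod_unfold)
  then show ?thesis
    unfolding times_ipser.rep_eq by (intro sum.neutral ballI)
qed

lemma kappa_factor_nth:
  "fps_nth (kappa_factor i) n = (if n = 0 then 1 else 2 * xvar i ^ n)"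
proof -
  let ?c = "fps_const (xvar i)" and ?G = "Abs_fps (\<lambda>n. xvar i ^ n)"
  have "fps_nth (kappa_factor i) n = fps_nth ?G n + fps_nth (?c * (fps_X * ?G)) n"
    by (simp only: kappa_factor_def distrib_right mult_1_left mult.assoc fps_add_nth)
  also have "\<dots> = xvar i ^ n + xvar i * (if n = 0 then 0 else xvar i ^ (n - 1))"
    by (simp only: fps_mult_left_const_nth fps_X_mult_nth fps_nth_Abs_fps)
  also have "\<dots> = (if n = 0 then 1 else 2 * xvar i ^ n)"
    by (cases n) (simp_all only: power_0 power_Suc diff_Suc_1 mult_2 nat.simps if_True if_False
        mult_zero_right add_0_right refl)
  finally show ?thesis .
qed

lemma icoeff_sum: "icoeff (sum f A) m = (\<Sum>a\<in>A. icoeff (f a) m)"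
  by (induction A rule: infinite_finite_induct) (auto simp: plus_ipser.rep_eq zero_ipser.rep_eq)

lemma icoeff_mult_kappa_factor:
  assumes "Poly_Mapping.lookup m i = 0"
  shows "icoeff (fps_nth (F * kappa_factor i) n) m = icoeff (fps_nth F n) m"
proof -
  let ?t = "\<lambda>k. icoeff (fps_nth F k * fps_nth (kappa_factor i) (n - k)) m"
  have t: "?t k = 0" if "k < n" for k
  proof -
    from that obtain j where j: "n - k = Suc j"
      by (metis Suc_diff_Suc)
    have "fps_nth F k * fps_nth (kappa_factor i) (n - k)
        = (fps_nth F k * (2 * xvar i ^ j)) * xvar i"
      unfolding j kappa_factor_nth by (simp add: ac_simps)
    then show ?thesis
      by (simp only: icoeff_mult_xvar_eq_0[OF assms])
  qed
  have "icoeff (fps_nth (F * kappa_factor i) n) m = (\<Sum>k = 0..n. ?t k)"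
    by (simp only: fps_mult_nth icoeff_sum)
  also have "\<dots> = (\<Sum>k \<in> {n}. ?t k)"
  proof (rule sum.mono_neutral_right)
    show "\<forall>k \<in> {0..n} - {n}. ?t k = 0"
      by (intro ballI t) auto
  qed simp_all
  also have "\<dots> = icoeff (fps_nth F n) m"
    by (simp add: kappa_factor_nth)
  finally show ?thesis .
qed

lemma kappa_partial_products:
  "eventually (\<lambda>N. icoeff (fps_nth (\<Prod>i<N. kappa_factor i) n) m
      = icoeff (fps_nth kappa n) m) sequentially"
proof -
  let ?c = "\<lambda>N. icoeff (fps_nth (\<Prod>i<N. kappa_factor i) n) m"
  obtain K where K: "\<And>i. i \<ge> K \<Longrightarrow> Poly_Mapping.lookup m i = 0"
  proof -
    obtain K where "\<forall>i \<in> Poly_Mapping.keys m. i < K"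
      using finite_nat_set_iff_bounded finite_keys by blast
    then show thesis
      by (metis that in_keys_iff leD)
  qed
  have const: "?c N = ?c K" if "N \<ge> K" for N
    using that by (induction N rule: dec_induct) (auto simp: K icoeff_mult_kappa_factor)
  then have ev: "eventually (\<lambda>N. ?c N = ?c K) sequentially"
    by (rule eventually_sequentiallyI)
  then have "?c \<longlonglongrightarrow> ?c K"
    by (rule tendsto_eventually)
  then have "lim ?c = ?c K"
    by (rule limI)
  then have "icoeff (fps_nth kappa n) m = ?c K"
    by (simp add: kappa_def Abs_ipser_inverse)
  then show ?thesis using ev by (simp only:)
qed


section \<open>Pfaffians and the functions \<open>Q\<^sub>\<lambda>\<close>\<close>

text \<open>Rows and columns are indexed from 0, so the sign is \<open>(-1)\<^sup>j\<^sup>+\<^sup>1\<close>. Only matrices of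
  even size matter; the value is 0 in odd size.\<close>

function pfaffian :: "'a :: comm_ring_1 mat \<Rightarrow> 'a" where
  "pfaffian A = (if dim_row A = 0 then 1
     else \<Sum>j = 1..<dim_row A.
       (-1) ^ (j + 1) * A $$ (0, j) * pfaffian (mat_delete (mat_delete A j j) 0 0))"
  by auto
termination
proof (relation "measure dim_row")
  fix A :: "'a mat" and j
  assume "dim_row A \<noteq> 0" "j \<in> {1..<dim_row A}"
  then show "(mat_delete (mat_delete A j j) 0 0, A) \<in> measure dim_row"
    by (simp only: in_measure mat_delete_dim)
qed simp

declare pfaffian.simps [simp del]

definition Q2 :: "int \<Rightarrow> int \<Rightarrow> ipser" where
  "Q2 r s = q r * q s + 2 * (\<Sum>i = 1..s. (-1) ^ nat i * q (r + i) * q (s - i))"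

definition Qmat :: "int list \<Rightarrow> ipser mat" where
  "Qmat \<nu> = mat (length \<nu>) (length \<nu>) (\<lambda>(i, j).
     if i < j then Q2 (\<nu> ! i) (\<nu> ! j) else if i = j then 0 else - Q2 (\<nu> ! j) (\<nu> ! i))"

definition Qfun :: "int list \<Rightarrow> ipser" where
  "Qfun lam = pfaffian (Qmat (if even (length lam) then lam else lam @ [0]))"

definition is_partition :: "int list \<Rightarrow> bool" where
  "is_partition lam \<longleftrightarrow> sorted_wrt (\<ge>) lam \<and> (\<forall>x \<in> set lam. x \<ge> 0)"

definition is_strict :: "int list \<Rightarrow> bool" where
  "is_strict lam \<longleftrightarrow> distinct (filter (\<lambda>x. x \<noteq> 0) lam)"

definition len :: "int list \<Rightarrow> nat" where
  "len lam = length (filter (\<lambda>x. x \<noteq> 0) lam)"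

text \<open>Strict partitions up to trailing zeros, represented by the ones without zero parts.\<close>

definition strict_partitions :: "int list set" where
  "strict_partitions = {lam. is_partition lam \<and> is_strict lam \<and> 0 \<notin> set lam}"


section \<open>The ring \<open>\<Gamma>\<close>, its inner product and adjoints\<close>

inductive_set Gamma :: "ipser set" where
  Gamma_of_int: "of_int k \<in> Gamma"
| Gamma_q: "n \<ge> 1 \<Longrightarrow> q n \<in> Gamma"
| Gamma_add: "F \<in> Gamma \<Longrightarrow> G \<in> Gamma \<Longrightarrow> F + G \<in> Gamma"
| Gamma_mult: "F \<in> Gamma \<Longrightarrow> G \<in> Gamma \<Longrightarrow> F * G \<in> Gamma"

text \<open>The \<open>Q\<^sub>\<lambda>\<close> with \<open>\<lambda>\<close> in \<^const>\<open>strict_partitions\<close> form a \<open>\<int>\<close>-basis of \<open>\<Gamma>\<close>;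
  \<open>Qcoord F \<lambda>\<close> is the coordinate of \<open>F \<in> \<Gamma>\<close> at \<open>Q\<^sub>\<lambda>\<close>.\<close>

definition Qcoord :: "ipser \<Rightarrow> int list \<Rightarrow> int" where
  "Qcoord F = (THE c. finite {lam. c lam \<noteq> 0} \<and> {lam. c lam \<noteq> 0} \<subseteq> strict_partitions \<and>
     F = (\<Sum>lam | c lam \<noteq> 0. of_int (c lam) * Qfun lam))"

text \<open>The bilinear form on \<open>\<Gamma>\<close> with \<open>(Q\<^sub>\<lambda>, Q\<^sub>\<mu>) = 2\<^bsup>\<ell>(\<lambda>)\<^esup> \<delta>\<^bsub>\<lambda>\<mu>\<^esub>\<close> on basis elements.\<close>

definition Qinner :: "ipser \<Rightarrow> ipser \<Rightarrow> int" where
  "Qinner F G = (\<Sum>lam | Qcoord F lam \<noteq> 0 \<and> Qcoord G lam \<noteq> 0.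
     2 ^ len lam * Qcoord F lam * Qcoord G lam)"

definition perp :: "ipser \<Rightarrow> ipser \<Rightarrow> ipser" where
  "perp F H = (THE K. K \<in> Gamma \<and> (\<forall>G \<in> Gamma. Qinner (F * G) H = Qinner G K))"


section \<open>Two-sided formal series in \<open>z\<close>\<close>

text \<open>A series \<open>\<Sum>\<^sub>p F\<^sub>p z\<^sup>p\<close> over \<open>p \<in> \<int>\<close> is the function \<open>p \<mapsto> F\<^sub>p\<close>. The product is
  meaningful when for each \<open>p\<close> only finitely many terms contribute to the coefficient of
  \<open>z\<^sup>p\<close>, e.g. for one factor with finitely many nonzero terms (\<^const>\<open>Sum_any\<close> is the sum over
  the nonzero terms).\<close>

definition series_mult :: "(int \<Rightarrow> ipser) \<Rightarrow> (int \<Rightarrow> ipser) \<Rightarrow> int \<Rightarrow> ipser" where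
  "series_mult A B p = Sum_any (\<lambda>m. A m * B (p - m))"

definition series_perp :: "(int \<Rightarrow> ipser) \<Rightarrow> ipser \<Rightarrow> int \<Rightarrow> ipser" where
  "series_perp F H = (\<lambda>p. perp (F p) H)"

text \<open>The series \<open>\<kappa>\<^sub>z\<close> and its image under the substitution \<open>z \<mapsto> -1/z\<close>.\<close>

definition kappa_z :: "int \<Rightarrow> ipser" where
  "kappa_z p = q p"

definition kappa_minus_inv_z :: "int \<Rightarrow> ipser" where
  "kappa_minus_inv_z p = (if even p then q (- p) else - q (- p))"

end

theory Submission
  imports Defs
begin

text \<open>
  Let \<open>D\<^sub>n F\<close> be the coefficient of \<open>y\<^sup>n\<close> in \<open>F(y, x\<^sub>0, x\<^sub>1, \<dots>)\<close>. Since \<open>F \<mapsto> F(y, x)\<close> is a ring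
  homomorphism that multiplies \<open>\<kappa>\<^sub>w\<close> by \<open>(1 + y w) / (1 - y w)\<close>, the coefficients \<open>\<phi>\<^sub>p\<close> of
  \<open>\<phi>(z) F = \<kappa>\<^sub>z F(-1/z, x)\<close> satisfy the Clifford relations
  \<open>\<phi>\<^sub>p \<phi>\<^sub>r + \<phi>\<^sub>r \<phi>\<^sub>p = 2 (-1)\<^sup>p \<delta>\<^bsub>p,-r\<^esub>\<close>. Two facts remain.

  First, \<open>Q\<^sub>\<lambda> = \<phi>\<^bsub>\<lambda>\<^sub>1\<^esub> \<dots> \<phi>\<^bsub>\<lambda>\<^sub>n\<^esub> 1\<close>. This is Schur's Pfaffian identity; it follows from the partial
  fraction expansion in \<open>y\<close> of \<open>\<Prod>\<^sub>i (1 + y z\<^sub>i) / (1 - y z\<^sub>i)\<close>, which expresses \<open>D\<^sub>n\<close> of such a word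
  by words with one letter less.

  Second, \<open>D\<^sub>n\<close> is adjoint to multiplication by \<open>q\<^sub>n\<close>. Up to sign, \<open>\<phi>\<^bsub>-p\<^esub>\<close> is the adjoint of \<open>\<phi>\<^sub>p\<close>:
  the functionals \<open>G \<mapsto>\<close> constant term of \<open>\<phi>\<^sup>*\<^bsub>\<lambda>\<^sub>n\<^esub> \<dots> \<phi>\<^sup>*\<^bsub>\<lambda>\<^sub>1\<^esub> G\<close> obey the same straightening
  rules as the words \<open>Q\<^sub>\<lambda>\<close>, are dual to them for strict \<open>\<lambda>\<close> by the Clifford relations, and composing
  them with \<open>D\<^sub>n\<close> corresponds to multiplying the words by \<open>q\<^sub>n\<close>. Linear independence of the strict
  \<open>Q\<^sub>\<lambda>\<close> is a by-product.
\<close>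

section \<open>Splitting off the first variable\<close>

text \<open>The new variable \<open>y\<close> takes index 0 and every old variable moves up by one
  index, so that series in \<open>y\<close> and the \<open>xvar i\<close> are again of type
  \<open>ipser\<close>.\<close>

lift_definition mon_cons :: "nat \<Rightarrow> monomial \<Rightarrow> monomial" is
  "\<lambda>n m i. case i of 0 \<Rightarrow> n | Suc j \<Rightarrow> m j"
proof -
  fix n :: nat and m :: "nat \<Rightarrow> nat"
  assume "finite {i. m i \<noteq> 0}"
  moreover have "{i. (case i of 0 \<Rightarrow> n | Suc j \<Rightarrow> m j) \<noteq> 0} \<subseteq> insert 0 (Suc ` {i. m i \<noteq> 0})"
  proof
    fix i assume "i \<in> {i. (case i of 0 \<Rightarrow> n | Suc j \<Rightarrow> m j) \<noteq> 0}"
    then show "i \<in> insert 0 (Suc ` {i. m i \<noteq> 0})" by (cases i) auto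
  qed
  ultimately show "finite {i. (case i of 0 \<Rightarrow> n | Suc j \<Rightarrow> m j) \<noteq> 0}"
    by (meson finite.insertI finite_imageI finite_subset)
qed

lift_definition mon_tail :: "monomial \<Rightarrow> monomial" is "\<lambda>m i. m (Suc i)"
proof -
  fix m :: "nat \<Rightarrow> nat"
  assume "finite {i. m i \<noteq> 0}"
  moreover have "Suc ` {i. m (Suc i) \<noteq> 0} \<subseteq> {i. m i \<noteq> 0}" by auto
  ultimately show "finite {i. m (Suc i) \<noteq> 0}"
    by (meson finite_imageD finite_subset inj_Suc inj_on_subset subset_UNIV)
qed

lemma mon_cons_head_tail: "mon_cons (Poly_Mapping.lookup m 0) (mon_tail m) = m"
  by transfer (auto split: nat.splits)

lemma lookup_mon_cons_0 [simp]: "Poly_Mapping.lookup (mon_cons n m) 0 = n"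
  by transfer simp

lemma mon_tail_mon_cons [simp]: "mon_tail (mon_cons n m) = m"
  by transfer simp

lemma mon_cons_inject [simp]: "mon_cons a m = mon_cons b k \<longleftrightarrow> a = b \<and> m = k"
  by transfer (auto simp: fun_eq_iff split: nat.splits)

lemma mon_cons_0_0 [simp]: "mon_cons 0 0 = 0"
  by transfer (auto split: nat.splits)

lemma mon_cons_add: "mon_cons a m + mon_cons b k = mon_cons (a + b) (m + k)"
  by transfer (auto split: nat.splits)

lemma mon_cons_single_0: "mon_cons 1 0 = Poly_Mapping.single 0 1"
  by transfer (auto split: nat.splits simp: when_def)

lemma mon_cons_single_Suc: "mon_cons 0 (Poly_Mapping.single i k) = Poly_Mapping.single (Suc i) k"
  by transfer (auto split: nat.splits simp: when_def)

lemma mon_cases: obtains n m' where "m = mon_cons n m'"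
  by (metis mon_cons_head_tail)

lemma mon_cons_eq_0 [simp]: "mon_cons n m = 0 \<longleftrightarrow> n = 0 \<and> m = 0"
  by (metis mon_cons_0_0 mon_cons_inject)

text \<open>\<open>\<Sum>\<^sub>n qperp_nat n F y\<^sup>n\<close> is the series \<open>F(y, x\<^sub>0, x\<^sub>1, \<dots>)\<close>.\<close>

lift_definition qperp_nat :: "nat \<Rightarrow> ipser \<Rightarrow> ipser" is "\<lambda>n F m. F (mon_cons n m)" .

lemma qperp_nat_0 [simp]: "qperp_nat n 0 = 0"
  by transfer simp

lemma qperp_nat_1: "qperp_nat n 1 = (if n = 0 then 1 else 0)"
  by transfer (auto simp: fun_eq_iff)

lemma qperp_nat_add: "qperp_nat n (F + G) = qperp_nat n F + qperp_nat n G"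
  by transfer simp

lemma qperp_nat_mult_2: "qperp_nat n (2 * F) = 2 * qperp_nat n F"
  by (simp only: mult_2 qperp_nat_add)

lemma icoeff_mult_2: "icoeff (2 * F) m = 2 * icoeff F m"
  by (simp only: mult_2 plus_ipser.rep_eq)

lemma qperp_nat_uminus: "qperp_nat n (- F) = - qperp_nat n F"
  by transfer simp

lemma qperp_nat_sum: "qperp_nat n (sum f A) = (\<Sum>a\<in>A. qperp_nat n (f a))"
  by (induction A rule: infinite_finite_induct) (auto simp: qperp_nat_add)

text \<open>Putting a new variable in front is a ring homomorphism, read off here at
  \<open>y^n\<close>: a splitting of \<open>mon_cons n m\<close> is a splitting of \<open>n\<close>
  together with one of \<open>m\<close>.\<close>

lemma qperp_nat_mult: "qperp_nat n (F * G) = (\<Sum>i\<le>n. qperp_nat i F * qperp_nat (n - i) G)"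
proof -
  have "icoeff (qperp_nat n (F * G)) m = icoeff (\<Sum>i\<le>n. qperp_nat i F * qperp_nat (n - i) G) m" for m
  proof -
    let ?S = "\<lambda>m :: monomial. {(a, b). a + b = m}"
    have "icoeff (\<Sum>i\<le>n. qperp_nat i F * qperp_nat (n - i) G) m =
      (\<Sum>i\<le>n. \<Sum>(a, b)\<in>?S m. icoeff F (mon_cons i a) * icoeff G (mon_cons (n - i) b))"
      by (simp add: icoeff_sum times_ipser.rep_eq qperp_nat.rep_eq)
    also have "\<dots> = (\<Sum>(i, (a, b))\<in>Sigma {..n} (\<lambda>_. ?S m).
        icoeff F (mon_cons i a) * icoeff G (mon_cons (n - i) b))"
      by (subst sum.Sigma[symmetric]) (auto simp: case_prod_unfold)
    also have "\<dots> = (\<Sum>(a, b)\<in>?S (mon_cons n m). icoeff F a * icoeff G b)"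
    proof (rule sum.reindex_bij_witness[of _
        "\<lambda>(a, b). (Poly_Mapping.lookup a 0, (mon_tail a, mon_tail b))"
        "\<lambda>(i, (a, b)). (mon_cons i a, mon_cons (n - i) b)"], goal_cases)
      case (1 p)
      then show ?case by (auto simp: mon_cons_head_tail)
    next
      case (2 p)
      then show ?case by (auto simp: mon_cons_add)
    next
      case (3 p)
      moreover obtain i a j b where "p = (mon_cons i a, mon_cons j b)"
        by (metis mon_cons_head_tail surj_pair)
      ultimately show ?case by (auto simp: mon_cons_add)
    next
      case (4 p)
      moreover obtain i a j b where "p = (mon_cons i a, mon_cons j b)"
        by (metis mon_cons_head_tail surj_pair)
      ultimately show ?case by (auto simp: mon_cons_add)
    next
      case (5 p)
      then show ?case by (simp add: case_prod_unfold)
    qed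
    also have "\<dots> = icoeff (qperp_nat n (F * G)) m"
      by (simp add: times_ipser.rep_eq qperp_nat.rep_eq)
    finally show ?thesis ..
  qed
  then show ?thesis by (simp add: ipser_eq_iff)
qed

lemma qperp_nat_mult_left_const:
  assumes "\<And>i. i > 0 \<Longrightarrow> qperp_nat i G = 0"
  shows "qperp_nat n (F * G) = qperp_nat n F * qperp_nat 0 G"
proof -
  have "qperp_nat n (F * G) = (\<Sum>i\<in>{n}. qperp_nat i F * qperp_nat (n - i) G)"
    unfolding qperp_nat_mult by (rule sum.mono_neutral_right) (auto simp: assms)
  then show ?thesis by simp
qed

section \<open>The new variable in \<open>xvar i\<close> and \<open>kappa\<close>\<close>

lemma qperp_nat_xvar_0: "qperp_nat n (xvar 0) = (if n = 1 then 1 else 0)"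
  by (simp only: ipser_eq_iff qperp_nat.rep_eq xvar.rep_eq mon_cons_single_0[symmetric] mon_cons_inject)
     (auto simp: one_ipser.rep_eq zero_ipser.rep_eq)

lemma qperp_nat_xvar_Suc: "qperp_nat n (xvar (Suc i)) = (if n = 0 then xvar i else 0)"
  by (simp only: ipser_eq_iff qperp_nat.rep_eq xvar.rep_eq mon_cons_single_Suc[symmetric]
    mon_cons_inject)
     (auto simp: xvar.rep_eq zero_ipser.rep_eq)

lemma qperp_nat_xvar_0_power: "qperp_nat n (xvar 0 ^ k) = (if n = k then 1 else 0)"
proof (induction k arbitrary: n)
  case 0
  then show ?case by (simp add: qperp_nat_1)
next
  case (Suc k)
  have "qperp_nat n (xvar 0 ^ Suc k) = (\<Sum>i\<le>n. if i = 1 then (if n - i = k then 1 else 0) else 0)"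
    unfolding power_Suc qperp_nat_mult by (intro sum.cong) (auto simp: Suc.IH qperp_nat_xvar_0)
  also have "\<dots> = (if n = Suc k then 1 else 0)"
    by (subst sum.delta) auto
  finally show ?case .
qed

lemma qperp_nat_xvar_Suc_power: "qperp_nat n (xvar (Suc i) ^ k) = (if n = 0 then xvar i ^ k else 0)"
proof (induction k arbitrary: n)
  case 0
  then show ?case by (simp add: qperp_nat_1)
next
  case (Suc k)
  have "qperp_nat n (xvar (Suc i) ^ Suc k)
    = qperp_nat n (xvar (Suc i)) * qperp_nat 0 (xvar (Suc i) ^ k)"
    unfolding power_Suc by (rule qperp_nat_mult_left_const) (auto simp: Suc.IH)
  then show ?case by (simp add: Suc.IH qperp_nat_xvar_Suc)
qed

text \<open>The coefficients of \<open>(1 + y) / (1 - y)\<close>.\<close>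

definition cayley_coeff :: "nat \<Rightarrow> ipser" where "cayley_coeff n = (if n = 0 then 1 else 2)"

lemma qperp_nat_kappa_factor_0: "qperp_nat n (fps_nth (kappa_factor 0) k)
  = (if n = k then cayley_coeff n else 0)"
  by (simp add: kappa_factor_nth qperp_nat_1 qperp_nat_mult_2 qperp_nat_xvar_0_power cayley_coeff_def)

lemma qperp_nat_kappa_factor_Suc:
  "qperp_nat n (fps_nth (kappa_factor (Suc i)) k) = (if n = 0 then fps_nth (kappa_factor i) k else 0)"
  by (simp add: kappa_factor_nth qperp_nat_1 qperp_nat_mult_2 qperp_nat_xvar_Suc_power cayley_coeff_def)

text \<open>Factor 0 becomes \<open>(1 + y w) / (1 - y w)\<close>, and factor \<open>i + 1\<close>
  becomes factor \<open>i\<close>, free of \<open>y\<close>. Hence \<open>N + 1\<close> factors on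
  the left leave \<open>N\<close> on the right.\<close>

lemma qperp_nat_kappa_partial:
  "qperp_nat n (fps_nth (\<Prod>i<Suc N. kappa_factor i) k)
    = (if n \<le> k then cayley_coeff n * fps_nth (\<Prod>i<N. kappa_factor i) (k - n) else 0)"
proof (induction N arbitrary: n k)
  case 0
  then show ?case by (auto simp: qperp_nat_kappa_factor_0)
next
  case (Suc N)
  let ?P = "\<lambda>N. \<Prod>i<N. kappa_factor i"
  have "qperp_nat n (fps_nth (?P (Suc (Suc N))) k)
    = (\<Sum>j=0..k. qperp_nat n (fps_nth (?P (Suc N)) j * fps_nth (kappa_factor (Suc N)) (k - j)))"
    by (simp add: prod.lessThan_Suc[of _ "Suc N"] fps_mult_nth qperp_nat_sum del: prod.lessThan_Suc)
  also have "\<dots> = (\<Sum>j=0..k. qperp_nat n (fps_nth (?P (Suc N)) j) * fps_nth (kappa_factor N) (k - j))"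
    by (subst qperp_nat_mult_left_const) (auto simp: qperp_nat_kappa_factor_Suc)
  also have "\<dots> = (\<Sum>j=0..k. if n \<le> j then
      cayley_coeff n * fps_nth (?P N) (j - n) * fps_nth (kappa_factor N) (k - j) else 0)"
    by (intro sum.cong refl) (simp add: Suc.IH del: prod.lessThan_Suc)
  also have "\<dots> = (\<Sum>j\<in>{n..k}. cayley_coeff n * fps_nth (?P N) (j - n) * fps_nth (kappa_factor N)
    (k - j))"
    by (rule sum.mono_neutral_cong_right) auto
  also have "\<dots> = (if n \<le> k then cayley_coeff n * fps_nth (?P (Suc N)) (k - n) else 0)"
  proof (cases "n \<le> k")
    case True
    have "(\<Sum>j\<in>{n..k}. cayley_coeff n * fps_nth (?P N) (j - n) * fps_nth (kappa_factor N) (k - j))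
      = (\<Sum>j=0..k - n. cayley_coeff n * (fps_nth (?P N) j * fps_nth (kappa_factor N) (k - n - j)))"
      by (rule sum.reindex_bij_witness[of _ "\<lambda>j. j + n" "\<lambda>j. j - n"])
        (use True in \<open>auto simp: ac_simps\<close>)
    then show ?thesis using True by (simp add: fps_mult_nth sum_distrib_left)
  qed auto
  finally show ?case .
qed

lemma qperp_nat_kappa: "qperp_nat n (fps_nth kappa k)
  = (if n \<le> k then cayley_coeff n * fps_nth kappa (k - n) else 0)"
proof -
  let ?P = "\<lambda>N. \<Prod>i<N. kappa_factor i"
  have "icoeff (qperp_nat n (fps_nth kappa k)) m
    = icoeff (if n \<le> k then cayley_coeff n * fps_nth kappa (k - n) else 0) m" for m
  proof -
    have "eventually (\<lambda>N. icoeff (fps_nth (?P (Suc N)) k) (mon_cons n m)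
      = icoeff (fps_nth kappa k) (mon_cons n m)) sequentially"
      by (subst eventually_sequentially_Suc[of "\<lambda>N. icoeff (fps_nth (?P N) k) (mon_cons n m)
        = icoeff (fps_nth kappa k) (mon_cons n m)"]) (rule kappa_partial_products)
    moreover have "eventually (\<lambda>N. icoeff (fps_nth (?P N) (k - n)) m
      = icoeff (fps_nth kappa (k - n)) m) sequentially"
      by (rule kappa_partial_products)
    ultimately have "eventually (\<lambda>N. ?thesis) sequentially"
    proof eventually_elim
      case (elim N)
      then show ?case using arg_cong[OF qperp_nat_kappa_partial[of n N k], of "\<lambda>F. icoeff F m"]
        by (auto simp: qperp_nat.rep_eq cayley_coeff_def icoeff_mult_2 zero_ipser.rep_eq del:
          prod.lessThan_Suc)
    qed
    then show ?thesis by simp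
  qed
  then show ?thesis by (simp add: ipser_eq_iff)
qed

section \<open>Constant terms and the inverse of \<open>kappa\<close>\<close>

lemma icoeff_mult_0: "icoeff (F * G) 0 = icoeff F 0 * icoeff G 0"
proof -
  have "{(a, b). a + b = (0 :: monomial)} = {(0, 0)}"
    by (auto simp: poly_mapping_eq_iff lookup_add fun_eq_iff)
  then show ?thesis by (simp add: times_ipser.rep_eq)
qed

lemma icoeff_kappa_partial_0: "icoeff (fps_nth (\<Prod>i<N. kappa_factor i) k) 0 = (if k = 0 then 1 else 0)"
proof (induction N arbitrary: k)
  case 0
  then show ?case by (simp add: one_ipser.rep_eq zero_ipser.rep_eq)
next
  case (Suc N)
  have x: "icoeff (fps_nth (kappa_factor i) k) 0 = (if k = 0 then 1 else 0)" for i k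
  proof (cases k)
    case 0
    then show ?thesis by (simp add: kappa_factor_nth one_ipser.rep_eq)
  next
    case (Suc j)
    have "icoeff (xvar i ^ k) 0 = 0"
      unfolding Suc power_Suc2 by (rule icoeff_mult_xvar_eq_0) simp
    then show ?thesis using Suc by (simp add: kappa_factor_nth icoeff_mult_2 del: power_Suc)
  qed
  have "icoeff (fps_nth (\<Prod>i<Suc N. kappa_factor i) k) 0
    = (\<Sum>j=0..k. if j = 0 then if k = 0 then 1 else 0 else 0)"
    by (auto simp: fps_mult_nth icoeff_sum icoeff_mult_0 x Suc.IH intro!: sum.neutral)
  then show ?case by simp
qed

lemma icoeff_kappa_0: "icoeff (fps_nth kappa k) 0 = (if k = 0 then 1 else 0)"
proof -
  have "eventually (\<lambda>N. icoeff (fps_nth kappa k) 0 = (if k = 0 then 1 else 0)) sequentially"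
    using kappa_partial_products[of k 0] by eventually_elim (simp add: icoeff_kappa_partial_0)
  then show ?thesis by simp
qed

text \<open>A coefficient with positive exponent at index 0 vanishes; otherwise the exponent vector
  may be shifted down by one index. Shifting a nonzero monomial brings a positive exponent to index
  0 eventually; the bound \<open>N\<close> on its support limits the number of shifts.\<close>

lemma ipser_const_eqI:
  assumes "qperp_nat 0 F = F" "\<And>n. n > 0 \<Longrightarrow> qperp_nat n F = 0"
  shows "F = of_int (icoeff F 0)"
proof -
  have *: "icoeff F (mon_cons n m) = (if n = 0 then icoeff F m else 0)" for n m
    using assms(1) assms(2)[of n] by (metis qperp_nat.rep_eq neq0_conv zero_ipser.rep_eq)
  have "icoeff F m = 0" if "m \<noteq> 0" "\<forall>i\<in>Poly_Mapping.keys m. i < N" for m N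
    using that
  proof (induction N arbitrary: m)
    case 0
    then show ?case by auto
  next
    case (Suc N)
    obtain n m' where m: "m = mon_cons n m'" by (metis mon_cases)
    show ?case
    proof (cases "n = 0")
      case True
      have "Poly_Mapping.lookup m (Suc i) = Poly_Mapping.lookup m' i" for i
        unfolding m by transfer simp
      then have "\<forall>i\<in>Poly_Mapping.keys m'. i < N" using Suc.prems(2)
        by (metis Suc_less_eq in_keys_iff)
      moreover have "m' \<noteq> 0" using Suc.prems(1) m True by auto
      ultimately show ?thesis using Suc.IH[of m'] * m by simp
    qed (simp add: m *)
  qed
  moreover have "\<exists>N. \<forall>i\<in>Poly_Mapping.keys m. i < N" for m :: monomial
    using finite_nat_set_iff_bounded finite_keys by blast
  ultimately have nz: "icoeff F m = 0" if "m \<noteq> 0" for m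
    using that by blast
  have "of_nat k = Abs_ipser (\<lambda>m. if m = 0 then int k else 0)" for k
    by (induction k) (auto simp: ipser_eq_iff Abs_ipser_inverse zero_ipser.rep_eq
        one_ipser.rep_eq plus_ipser.rep_eq)
  then have "of_int k = Abs_ipser (\<lambda>m. if m = 0 then k else 0)" for k
    by (cases k rule: int_cases2) (auto simp: ipser_eq_iff Abs_ipser_inverse uminus_ipser.rep_eq)
  then show ?thesis using nz by (auto simp: ipser_eq_iff Abs_ipser_inverse)
qed


text \<open>The coefficients of \<open>\<kappa>\<^sub>z \<kappa>\<^sub>-\<^sub>z\<close> do not change when a variable is added, hence are constant.\<close>

lemma kappa_inverse: "kappa * Abs_fps (\<lambda>n. (-1) ^ n * fps_nth kappa n) = 1"
proof -
  define K where "K = Abs_fps (\<lambda>n. (-1) ^ n * fps_nth kappa n)"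
  define H where "H = kappa * K"
  have 1: "qperp_nat a (fps_nth kappa j) = fps_nth (fps_const (cayley_coeff a) * (fps_X ^ a * kappa)) j"
    for a j
    by (simp add: qperp_nat_kappa fps_X_power_mult_nth)
  have sgn: "qperp_nat a ((-1) ^ j * F) = (-1) ^ j * qperp_nat a F" for a j F
    by (cases "even j") (simp_all add: qperp_nat_uminus)
  have pm: "(-1) ^ j = (-1) ^ a * (-1 :: ipser) ^ (j - a)" if "a \<le> j" for a j :: nat
    using that by (simp flip: power_add)
  have 2: "qperp_nat a (fps_nth K j)
    = fps_nth (fps_const ((-1) ^ a * cayley_coeff a) * (fps_X ^ a * K)) j" for a j
    by (auto simp: K_def sgn qperp_nat_kappa fps_X_power_mult_nth pm[of a j])
  have c: "(\<Sum>a\<le>m. cayley_coeff a * ((-1) ^ (m - a) * cayley_coeff (m - a)))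
    = (if m = 0 then 1 else 0)" for m
  proof (cases m)
    case (Suc k)
    \<comment> \<open>\<open>f a\<close> is the partial sum of the terms up to \<open>a\<close>, and
      \<open>f m = 0\<close>.\<close>
    define f where "f a = (-1) ^ (m - a) * (if a = 0 then 2 else if a = m then 0 else 2 :: ipser)" for a
    have "(\<Sum>a\<le>m. cayley_coeff a * ((-1) ^ (m - a) * cayley_coeff (m - a)))
      = (\<Sum>a\<le>m. f a - (if a = 0 then 0 else f (a - 1)))"
    proof (rule sum.cong)
      fix a assume "a \<in> {..m}"
      then obtain d where "m = a + d" using le_Suc_ex by auto
      then show "cayley_coeff a * ((-1) ^ (m - a) * cayley_coeff (m - a))
        = f a - (if a = 0 then 0 else f (a - 1))"
        using Suc by (cases a) (auto simp: f_def cayley_coeff_def algebra_simps Suc_diff_le)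
    qed simp
    also have "\<dots> = f m"
      by (induction m) (auto simp: algebra_simps)
    finally show ?thesis using Suc by (simp add: f_def)
  qed (simp add: cayley_coeff_def)
  have DnH: "qperp_nat m (fps_nth H n) = (if m = 0 then fps_nth H n else 0)" for m n
  proof -
    have "qperp_nat m (fps_nth H n) = (\<Sum>j=0..n. \<Sum>a\<le>m.
        fps_nth (fps_const (cayley_coeff a) * (fps_X ^ a * kappa)) j
        * fps_nth (fps_const ((-1) ^ (m - a) * cayley_coeff (m - a)) * (fps_X ^ (m - a) * K)) (n - j))"
      unfolding H_def fps_mult_nth qperp_nat_sum qperp_nat_mult 1 2 ..
    also have "\<dots> = (\<Sum>a\<le>m. fps_nth (fps_const (cayley_coeff a) * (fps_X ^ a * kappa)
        * (fps_const ((-1) ^ (m - a) * cayley_coeff (m - a)) * (fps_X ^ (m - a) * K))) n)"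
      by (subst sum.swap) (simp only: fps_mult_nth)
    also have "\<dots> = (\<Sum>a\<le>m. cayley_coeff a * ((-1) ^ (m - a) * cayley_coeff (m - a)) * fps_nth
      (fps_X ^ m * H) n)"
    proof (intro sum.cong refl)
      fix a assume "a \<in> {..m}"
      then have "fps_X ^ m = fps_X ^ a * (fps_X ^ (m - a) :: ipser fps)"
        by (simp flip: power_add)
      then have "fps_const (cayley_coeff a) * (fps_X ^ a * kappa)
        * (fps_const ((-1) ^ (m - a) * cayley_coeff (m - a)) * (fps_X ^ (m - a) * K))
        = (fps_const (cayley_coeff a) * fps_const ((-1) ^ (m - a) * cayley_coeff (m - a))) *
          (fps_X ^ m * H)"
        unfolding H_def by (simp only: ac_simps)
      then show "fps_nth (fps_const (cayley_coeff a) * (fps_X ^ a * kappa)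
        * (fps_const ((-1) ^ (m - a) * cayley_coeff (m - a)) * (fps_X ^ (m - a) * K))) n
        = cayley_coeff a * ((-1) ^ (m - a) * cayley_coeff (m - a)) * fps_nth (fps_X ^ m * H) n"
        by (simp only: fps_const_mult fps_mult_left_const_nth)
    qed
    also have "\<dots> = (if m = 0 then fps_nth H n else 0)"
      by (simp flip: sum_distrib_right add: c)
    finally show ?thesis .
  qed
  have "fps_nth H n = of_int (icoeff (fps_nth H n) 0)" for n
    by (rule ipser_const_eqI) (auto simp: DnH)
  moreover have "icoeff (fps_nth H n) 0 = (if n = 0 then 1 else 0)" for n
  proof -
    have "icoeff (fps_nth H n) 0 = (\<Sum>j=0..n. if j = 0 then (if n = 0 then 1 else 0) else 0)"
      unfolding H_def fps_mult_nth icoeff_sum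
    proof (intro sum.cong refl)
      fix j assume "j \<in> {0..n}"
      have sgn: "icoeff ((-1) ^ k * F) 0 = (-1) ^ k * icoeff F 0" for k F
        by (cases "even k") (simp_all add: uminus_ipser.rep_eq)
      show "icoeff (fps_nth kappa j * fps_nth K (n - j)) 0 =
        (if j = 0 then (if n = 0 then 1 else 0) else 0)"
        using \<open>j \<in> {0..n}\<close> by (simp add: icoeff_mult_0[of "fps_nth kappa j"] K_def icoeff_kappa_0 sgn)
    qed
    then show ?thesis by simp
  qed
  ultimately have "fps_nth H n = (if n = 0 then 1 else 0)" for n
    by (metis of_int_0 of_int_1)
  then show ?thesis
    unfolding H_def[symmetric] K_def[symmetric] by (simp add: fps_eq_iff)
qed

section \<open>The operators on \<open>\<Gamma>\<close>\<close>

definition qperp :: "int \<Rightarrow> ipser \<Rightarrow> ipser" where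
  "qperp n F = (if n < 0 then 0 else qperp_nat (nat n) F)"

definition alt_sign :: "int \<Rightarrow> ipser" where
  "alt_sign n = (if even n then 1 else -1)"

lemma alt_sign_mult [simp]: "alt_sign a * alt_sign b = alt_sign (a + b)"
  by (auto simp: alt_sign_def)

lemma alt_sign_plus_1 [simp]:
  "alt_sign (a + 1) = - alt_sign a"
  "alt_sign (1 + a) = - alt_sign a"
  "alt_sign (a - 1) = - alt_sign a"
  by (auto simp: alt_sign_def)

lemma alt_sign_minus [simp]: "alt_sign (- a) = alt_sign a"
  by (auto simp: alt_sign_def)

lemma alt_sign_0 [simp]: "alt_sign 0 = 1"
  by (simp add: alt_sign_def)

lemma q_neg [simp]: "n < 0 \<Longrightarrow> q n = 0"
  by (simp add: q_def)

lemma q_0 [simp]: "q 0 = 1"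
proof -
  have "fps_nth kappa 0 = of_int (icoeff (fps_nth kappa 0) 0)"
    by (rule ipser_const_eqI) (auto simp: qperp_nat_kappa cayley_coeff_def)
  then show ?thesis by (simp add: q_def icoeff_kappa_0)
qed

lemma icoeff_q_0: "icoeff (q n) 0 = (if n = 0 then 1 else 0)"
  by (auto simp: q_def icoeff_kappa_0 zero_ipser.rep_eq)

lemma qperp_nat_q: "qperp_nat n (q k) = cayley_coeff n * q (k - int n)"
  by (auto simp: q_def qperp_nat_kappa nat_diff_distrib)

text \<open>The coefficients of \<open>kappa_inverse\<close>. Moving the sign to the other factor
  costs \<open>(-1) ^ n\<close>, which is harmless because the right side is 0 for
  \<open>n > 0\<close>.\<close>

lemma sum_q_alternating:
  "(\<Sum>j=0..int n. alt_sign j * (q j * q (int n - j))) = (if n = 0 then 1 else 0)"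
proof -
  have "(\<Sum>j=0..int n. alt_sign j * (q j * q (int n - j)))
    = (\<Sum>j=0..n. fps_nth kappa j * ((-1) ^ (n - j) * fps_nth kappa (n - j)) * (-1) ^ n)"
  proof (rule sum.reindex_bij_witness[of _ int nat])
    fix j assume "j \<in> {0..int n}"
    then obtain i where "j = int i" "i \<le> n"
      by (metis atLeastAtMost_iff nonneg_int_cases of_nat_le_iff)
    moreover have "(-1) ^ (n - i) * (-1) ^ n = (-1 :: ipser) ^ i" if "i \<le> n" for i
      using that by (simp add: minus_one_power_iff)
    ultimately show "fps_nth kappa (nat j) * ((-1) ^ (n - nat j) * fps_nth kappa (n - nat j)) * (-1) ^ n
      = alt_sign j * (q j * q (int n - j))"
      by (auto simp: q_def alt_sign_def minus_one_power_iff nat_diff_distrib)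
  qed auto
  also have "\<dots> = fps_nth (kappa * Abs_fps (\<lambda>n. (-1) ^ n * fps_nth kappa n)) n * (-1) ^ n"
    by (simp add: fps_mult_nth sum_distrib_right)
  finally show ?thesis by (simp add: kappa_inverse)
qed

lemma qperp_0 [simp]: "qperp n 0 = 0"
  by (simp add: qperp_def)

lemma qperp_neg [simp]: "n < 0 \<Longrightarrow> qperp n F = 0"
  by (simp add: qperp_def)

lemma qperp_add: "qperp n (F + G) = qperp n F + qperp n G"
  by (simp add: qperp_def qperp_nat_add)

lemma qperp_uminus: "qperp n (- F) = - qperp n F"
  by (simp add: qperp_def qperp_nat_uminus)

lemma qperp_1: "qperp n 1 = (if n = 0 then 1 else 0)"
  by (auto simp: qperp_def qperp_nat_1)

lemma qperp_sum: "qperp n (sum f A) = (\<Sum>a\<in>A. qperp n (f a))"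
  by (simp add: qperp_def qperp_nat_sum)

lemma qperp_alt_sign_mult: "qperp n (alt_sign m * F) = alt_sign m * qperp n F"
  by (simp add: alt_sign_def qperp_uminus)

lemma qperp_nat_q_mult: "qperp_nat n (q k * F)
  = (\<Sum>i\<le>n. cayley_coeff i * q (k - int i) * qperp_nat (n - i) F)"
  by (simp add: qperp_nat_mult qperp_nat_q)

text \<open>The new variable multiplies \<open>\<kappa>\<^sub>w\<close> by
  \<open>(1 + y w) / (1 - y w)\<close>. Clearing the denominator and comparing coefficients of
  \<open>y^n w^k\<close> gives a relation with four terms in place of a convolution.\<close>

lemma qperp_q_mult:
  "qperp n (q k * F) - qperp (n - 1) (q (k - 1) * F) = q k * qperp n F + q (k - 1) * qperp (n - 1) F"
proof (cases "n \<ge> 1")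
  case True
  then obtain m where n: "n = int (Suc m)"
    using True by (intro that[of "nat (n - 1)"]) simp
  have "qperp_nat (Suc m) (q k * F) = q k * qperp_nat (Suc m) F +
      (\<Sum>i\<le>m. 2 * q (k - 1 - int i) * qperp_nat (m - i) F)"
    unfolding qperp_nat_q_mult
      by (subst sum.atMost_Suc_shift) (simp add: cayley_coeff_def algebra_simps)
  also have "(\<Sum>i\<le>m. 2 * q (k - 1 - int i) * qperp_nat (m - i) F)
      = (\<Sum>i\<le>m. cayley_coeff i * q (k - 1 - int i) * qperp_nat (m - i) F +
        (if i = 0 then q (k - 1) * qperp_nat m F else 0))"
    by (intro sum.cong refl) (auto simp: cayley_coeff_def algebra_simps)
  also have "\<dots> = qperp_nat m (q (k - 1) * F) + q (k - 1) * qperp_nat m F"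
    unfolding qperp_nat_q_mult sum.distrib by simp
  finally show ?thesis using n by (simp add: qperp_def nat_add_distrib)
next
  case False
  then show ?thesis by (cases "n = 0") (simp_all add: qperp_def qperp_nat_q_mult cayley_coeff_def)
qed

section \<open>Generators of \<Gamma> and finiteness\<close>

lemma Gamma_0 [simp]: "0 \<in> Gamma" and Gamma_1 [simp]: "1 \<in> Gamma"
  using Gamma_of_int[of 0] Gamma_of_int[of 1] by simp_all

lemma Gamma_uminus: "F \<in> Gamma \<Longrightarrow> - F \<in> Gamma"
  using Gamma_mult[OF Gamma_of_int[of "-1"]] by simp

lemma Gamma_diff: "F \<in> Gamma \<Longrightarrow> G \<in> Gamma \<Longrightarrow> F - G \<in> Gamma"
  using Gamma_add[OF _ Gamma_uminus] by fastforce

lemma Gamma_sum: "(\<And>a. a \<in> A \<Longrightarrow> f a \<in> Gamma) \<Longrightarrow> sum f A \<in> Gamma"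
  by (induction A rule: infinite_finite_induct) (auto intro: Gamma_add)

lemma q_Gamma [simp]: "q n \<in> Gamma"
  by (cases "n \<ge> 1"; cases "n = 0") (auto intro: Gamma_q)

lemma alt_sign_Gamma [simp]: "alt_sign n \<in> Gamma"
  using Gamma_of_int[of "-1"] by (simp add: alt_sign_def)

lemma cayley_coeff_Gamma [simp]: "cayley_coeff n \<in> Gamma"
  using Gamma_of_int[of 2] by (simp add: cayley_coeff_def)

text \<open>The exchange relations move an operator past one generator \<open>q n\<close>, so
  generators have to be peeled off one at a time. The rule comes from the claim that
  \<open>P G\<close> implies \<open>P (F * G)\<close>, proved for all \<open>G\<close> along the
  generation of \<open>F\<close>.\<close>

lemma Gamma_q_induct [consumes 1, case_names one add uminus q]:
  assumes F: "F \<in> Gamma"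
    and one: "P 1"
    and add: "\<And>F G. F \<in> Gamma \<Longrightarrow> G \<in> Gamma \<Longrightarrow> P F \<Longrightarrow> P G \<Longrightarrow> P (F + G)"
    and uminus: "\<And>F. F \<in> Gamma \<Longrightarrow> P F \<Longrightarrow> P (- F)"
    and q: "\<And>n F. n \<ge> 1 \<Longrightarrow> F \<in> Gamma \<Longrightarrow> P F \<Longrightarrow> P (q n * F)"
  shows "P F"
proof -
  have "P (F * G)" if "G \<in> Gamma" "P G" for G
    using F that
  proof (induction F arbitrary: G)
    case (Gamma_of_int k)
    have zero: "P 0"
      using add[OF _ _ one uminus[OF _ one]] Gamma_uminus[OF Gamma_1] by simp
    have "P (of_nat n * G)" for n
      by (induction n) (use zero Gamma_of_int add Gamma_mult[OF Gamma.Gamma_of_int[of "int _"]] in \<open>auto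
        simp: distrib_right\<close>)
    then show ?case
      using uminus[OF Gamma_mult[OF Gamma.Gamma_of_int[of "int _"]]] Gamma_of_int
      by (cases k rule: int_cases2) auto
  next
    case (Gamma_add F F')
    then show ?case by (simp add: distrib_right add Gamma_mult)
  next
    case (Gamma_mult F F')
    then show ?case by (simp add: mult.assoc Gamma.Gamma_mult)
  qed (auto intro: q)
  from this[of 1] show ?thesis using one by simp
qed

lemma qperp_nat_Gamma:
  assumes "F \<in> Gamma"
  shows "qperp_nat n F \<in> Gamma"
  using assms
proof (induction F arbitrary: n rule: Gamma_q_induct)
  case (q k F)
  then show ?case unfolding qperp_nat_q_mult by (intro Gamma_sum Gamma_mult) auto
qed (auto simp: qperp_nat_1 qperp_nat_add qperp_nat_uminus Gamma_uminus intro: Gamma_add)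

lemma qperp_Gamma [simp]: "F \<in> Gamma \<Longrightarrow> qperp n F \<in> Gamma"
  by (simp add: qperp_def qperp_nat_Gamma)

lemma qperp_nat_eventually_0:
  assumes "F \<in> Gamma"
  shows "\<exists>N. \<forall>n>N. qperp_nat n F = 0"
  using assms
proof (induction F rule: Gamma_q_induct)
  case (add F G)
  then obtain N M where "\<forall>n>N. qperp_nat n F = 0" "\<forall>n>M. qperp_nat n G = 0" by auto
  then have "\<forall>n>N + M. qperp_nat n (F + G) = 0" by (simp add: qperp_nat_add)
  then show ?case ..
next
  case (q k F)
  then obtain N where N: "\<forall>n>N. qperp_nat n F = 0" by auto
  have "qperp_nat n (q k * F) = 0" if "n > N + nat k" for n
    unfolding qperp_nat_q_mult
  proof (rule sum.neutral, intro ballI)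
    fix i assume "i \<in> {..n}"
    have "k - int i < 0 \<or> n - i > N" using that by linarith
    then show "cayley_coeff i * q (k - int i) * qperp_nat (n - i) F = 0" using N by auto
  qed
  then show ?case by blast
qed (auto simp: qperp_nat_1 qperp_nat_uminus)

lemma qperp_support:
  assumes "F \<in> Gamma"
  shows "\<exists>N. \<forall>n. n \<notin> {0..N} \<longrightarrow> qperp n F = 0"
proof -
  obtain N where "\<forall>n>N. qperp_nat n F = 0" using qperp_nat_eventually_0[OF assms] ..
  then have "qperp n F = 0" if "n \<notin> {0..int N}" for n
    using that by (auto simp: qperp_def)
  then show ?thesis by blast
qed

text \<open>The two sides introduce two new variables in opposite order. They agree because elements
  of \<Gamma> are symmetric, which shows here as the symmetry of the double sum for
  \<open>q k * F\<close>.\<close>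

lemma qperp_nat_commute:
  assumes "F \<in> Gamma"
  shows "qperp_nat n (qperp_nat m F) = qperp_nat m (qperp_nat n F)"
  using assms
proof (induction F arbitrary: n m rule: Gamma_q_induct)
  case (q k F)
  have cayley_coeff: "qperp_nat n (cayley_coeff i * F) = cayley_coeff i * qperp_nat n F" for i n F
    by (simp add: cayley_coeff_def qperp_nat_mult_2)
  have eq: "qperp_nat n (qperp_nat m (q k * F)) = (\<Sum>i\<le>m. \<Sum>j\<le>n.
      cayley_coeff i * cayley_coeff j * q (k - int i - int j) * qperp_nat (n - j)
        (qperp_nat (m - i) F))" for n m
    by (simp add: qperp_nat_q_mult qperp_nat_sum cayley_coeff mult.assoc sum_distrib_left)
  show ?case unfolding eq
    by (subst sum.swap) (simp add: q.IH mult.commute mult.left_commute diff_diff_add add.commute)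
qed (auto simp: qperp_nat_1 qperp_nat_add qperp_nat_uminus)

lemma qperp_commute: "F \<in> Gamma \<Longrightarrow> qperp n (qperp m F) = qperp m (qperp n F)"
  by (simp add: qperp_def qperp_nat_commute)

text \<open>The coefficient of \<open>z\<^sup>p\<close> in the operator \<open>F \<mapsto> \<kappa>\<^sub>z F(-1/z, x\<^sub>0, x\<^sub>1, \<dots>)\<close>. On \<open>\<Gamma>\<close> this
  is a finite sum.\<close>

definition vertex :: "int \<Rightarrow> ipser \<Rightarrow> ipser" where
  "vertex p F = Sum_any (\<lambda>m. alt_sign m * q (p + m) * qperp m F)"

lemma vertex_eq_sum:
  assumes "finite A" "\<And>m. m \<notin> A \<Longrightarrow> qperp m F = 0"
  shows "vertex p F = (\<Sum>m\<in>A. alt_sign m * q (p + m) * qperp m F)"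
proof -
  have "qperp m F \<noteq> 0 \<longrightarrow> m \<in> A" for m using assms(2) by blast
  then have "{m. alt_sign m * q (p + m) * qperp m F \<noteq> 0} \<subseteq> A"
    by (auto, metis mult_zero_right)
  then show ?thesis unfolding vertex_def by (rule Sum_any.expand_superset[OF assms(1)])
qed

text \<open>The index is shifted so that \<open>vertex p\<close> and \<open>vertex (p + 1)\<close>
  become sums with the same coefficients \<open>alt_sign m * q (p + m)\<close>; the shift costs a
  sign.\<close>

lemma vertex_plus_1_eq_sum:
  assumes "finite A" "\<And>m. m \<notin> A \<Longrightarrow> qperp (m - 1) F = 0"
  shows "vertex (p + 1) F = - (\<Sum>m\<in>A. alt_sign m * q (p + m) * qperp (m - 1) F)"
proof -
  have "vertex (p + 1) F = (\<Sum>m\<in>(\<lambda>m. m - 1) ` A. alt_sign m * q (p + 1 + m) * qperp m F)"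
  proof (rule vertex_eq_sum)
    fix m assume "m \<notin> (\<lambda>m. m - 1) ` A"
    then have "m + 1 \<notin> A" by force
    then show "qperp m F = 0" using assms(2) by fastforce
  qed (use assms in auto)
  also have "\<dots> = (\<Sum>m\<in>A. - (alt_sign m * q (p + m) * qperp (m - 1) F))"
    by (subst sum.reindex) (auto simp: inj_on_def)
  finally show ?thesis by (simp add: sum_negf)
qed

lemma vertex_Gamma [simp]:
  assumes "F \<in> Gamma"
  shows "vertex p F \<in> Gamma"
proof -
  obtain N where "\<And>n. n \<notin> {0..N} \<Longrightarrow> qperp n F = 0" using qperp_support[OF assms] by blast
  then show ?thesis
    by (subst vertex_eq_sum[of "{0..N}"]) (auto intro!: Gamma_sum Gamma_mult simp: assms)
qed

lemma vertex_add:
  assumes "F \<in> Gamma" "G \<in> Gamma"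
  shows "vertex p (F + G) = vertex p F + vertex p G"
proof -
  obtain N where N: "\<And>n. n \<notin> {0..N} \<Longrightarrow> qperp n F = 0" using qperp_support[OF assms(1)] by blast
  obtain M where M: "\<And>n. n \<notin> {0..M} \<Longrightarrow> qperp n G = 0" using qperp_support[OF assms(2)] by blast
  let ?A = "{0..N} \<union> {0..M}"
  have z: "qperp n F = 0" "qperp n G = 0" "qperp n (F + G) = 0" if "n \<notin> ?A" for n
    using N M that by (auto simp: qperp_add)
  show ?thesis
    by (simp add: vertex_eq_sum[of ?A] z qperp_add sum.distrib distrib_left del: Un_iff)
qed

lemma vertex_0 [simp]: "vertex p 0 = 0"
  by (simp add: vertex_def)

lemma vertex_uminus:
  assumes "F \<in> Gamma"
  shows "vertex p (- F) = - vertex p F"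
  using vertex_add[OF assms Gamma_uminus[OF assms], of p] by (simp add: add_eq_0_iff)

lemma vertex_diff: "F \<in> Gamma \<Longrightarrow> G \<in> Gamma \<Longrightarrow> vertex p (F - G) = vertex p F - vertex p G"
  using vertex_add[OF _ Gamma_uminus, of F G p] by (simp add: vertex_uminus)

section \<open>Exchange relations for the vertex operators\<close>

lemma vertex_1: "vertex p 1 = q p"
  by (subst vertex_eq_sum[of "{0}"]) (auto simp: qperp_1)

text \<open>The coefficient of \<open>z^p w^s\<close> in \<open>(1 + w/z) \<phi>(z) \<kappa>\<^sub>w
  F = (1 - w/z) \<kappa>\<^sub>w \<phi>(z) F\<close>, which is \<open>qperp_q_mult\<close> at
  \<open>y = -1/z\<close>.\<close>

lemma vertex_q_mult:
  assumes "F \<in> Gamma"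
  shows "vertex p (q s * F) + vertex (p + 1) (q (s - 1) * F)
    = q s * vertex p F - q (s - 1) * vertex (p + 1) F"
proof -
  obtain N where N: "\<And>n. n \<notin> {0..N} \<Longrightarrow> qperp n F = 0" using qperp_support[OF assms] by blast
  obtain N1 where N1: "\<And>n. n \<notin> {0..N1} \<Longrightarrow> qperp n (q s * F) = 0"
    using qperp_support[OF Gamma_mult[OF q_Gamma assms]] by blast
  obtain N2 where N2: "\<And>n. n \<notin> {0..N2} \<Longrightarrow> qperp n (q (s - 1) * F) = 0"
    using qperp_support[OF Gamma_mult[OF q_Gamma assms]] by blast
  \<comment> \<open>The added 1 makes room for the shifted terms with
    \<open>qperp (m - 1)\<close>.\<close>
  define A where "A = {0..\<bar>N\<bar> + \<bar>N1\<bar> + \<bar>N2\<bar> + 1}"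
  have z: "qperp n F = 0" "qperp n (q s * F) = 0" "qperp (n - 1) F = 0"
    "qperp (n - 1) (q (s - 1) * F) = 0"
    if "n \<notin> A" for n
    using that unfolding A_def by (auto intro!: N N1 N2)
  have A: "finite A" by (simp add: A_def)
  have "vertex p (q s * F) + vertex (p + 1) (q (s - 1) * F)
    = (\<Sum>m\<in>A. alt_sign m * q (p + m) * (qperp m (q s * F) - qperp (m - 1) (q (s - 1) * F)))"
    by (simp add: vertex_eq_sum[OF A z(2), where p = p]
        vertex_plus_1_eq_sum[OF A z(4)] right_diff_distrib sum_subtractf)
  also have "\<dots> = (\<Sum>m\<in>A. alt_sign m * q (p + m) * (q s * qperp m F + q (s - 1) * qperp (m - 1) F))"
    by (simp only: qperp_q_mult)
  also have "\<dots> = q s * vertex p F - q (s - 1) * vertex (p + 1) F"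
    by (simp add: vertex_eq_sum[OF A z(1), where p = p] vertex_plus_1_eq_sum[OF A z(3)]
        distrib_left sum.distrib sum_distrib_left mult.assoc mult.commute mult.left_commute)
  finally show ?thesis .
qed

text \<open>The coefficient of \<open>y^n z^p\<close> after the denominator of
  \<open>(1 + y z) / (1 - y z)\<close> is cleared; this is the factor that the new variable adds to
  \<open>\<kappa>\<^sub>z\<close> inside \<open>\<phi>(z)\<close>.\<close>

lemma qperp_vertex:
  assumes "F \<in> Gamma"
  shows "qperp n (vertex p F) - qperp (n - 1) (vertex (p - 1) F)
    = vertex p (qperp n F) + vertex (p - 1) (qperp (n - 1) F)"
proof -
  obtain N where N: "\<And>n. n \<notin> {0..N} \<Longrightarrow> qperp n F = 0" using qperp_support[OF assms] by blast
  have z: "qperp m (qperp k F) = 0" if "m \<notin> {0..N}" for m k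
    using that by (simp add: qperp_commute assms N del: atLeastAtMost_iff)
  have pF: "vertex p F = (\<Sum>m=0..N. alt_sign m * q (p + m) * qperp m F)" for p
    by (rule vertex_eq_sum[OF _ N]) auto
  have pDF: "vertex p (qperp k F) = (\<Sum>m=0..N. alt_sign m * q (p + m) * qperp m (qperp k F))" for p k
    by (rule vertex_eq_sum[OF _ z]) auto
  have "qperp n (vertex p F) - qperp (n - 1) (vertex (p - 1) F) = (\<Sum>m=0..N. alt_sign m *
      (qperp n (q (p + m) * qperp m F) - qperp (n - 1) (q (p + m - 1) * qperp m F)))"
    by (simp add: pF qperp_sum qperp_alt_sign_mult mult.assoc sum_subtractf right_diff_distrib
        diff_add_eq)
  also have "\<dots> = vertex p (qperp n F) + vertex (p - 1) (qperp (n - 1) F)"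
    by (simp add: pDF qperp_q_mult qperp_commute[OF assms, of _ n] qperp_commute[OF assms, of _ "n - 1"]
      mult.assoc sum.distrib distrib_left diff_add_eq)
  finally show ?thesis .
qed

section \<open>Clifford relations\<close>

lemma ipser_2_cancel: "2 * F = 2 * (G :: ipser) \<Longrightarrow> F = G"
  by (metis icoeff_mult_2 ipser_eq_iff mult_cancel_left zero_neq_numeral)

text \<open>A rule for adding two known equations: only an algebraic identity remains to be
  shown.\<close>

lemma eq_if_diff_eq:
  fixes x :: "'a :: ab_group_add"
  assumes "a = b" "c = d" "x - y = (a - b) + (c - d)"
  shows "x = y"
  using assms by simp

lemma qperp_0_id: "F \<in> Gamma \<Longrightarrow> qperp 0 F = F"
proof (induction F rule: Gamma_q_induct)
  case (q k F)
  then show ?case by (simp add: qperp_def qperp_nat_q_mult cayley_coeff_def)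
qed (auto simp: qperp_1 qperp_add qperp_uminus)

lemma qperp_q: "qperp n (q k) = (if n < 0 then 0 else cayley_coeff (nat n) * q (k - n))"
  by (simp add: qperp_def qperp_nat_q)

definition clifford_const :: "int \<Rightarrow> int \<Rightarrow> ipser" where
  "clifford_const p r = (if p + r = 0 then 2 * alt_sign p else 0)"

text \<open>For \<open>n \<ge> 1\<close> the factor \<open>q (-1 + m)\<close> kills
  \<open>m = 0\<close> and every other term carries a factor 2. Shifting the index by one leaves the
  sum of \<open>sum_q_alternating\<close>.\<close>

lemma vertex_minus_1_q: "vertex (-1) (q n) = (if n = 1 then - 2 else 0)"
proof (cases "n \<ge> 1")
  case True
  then obtain k where n: "n = int k + 1"
    by (metis add.commute le_add_diff_inverse zle_iff_zadd)
  have "vertex (-1) (q n) = (\<Sum>m\<in>{0..n}. alt_sign m * q (-1 + m) * qperp m (q n))"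
    by (rule vertex_eq_sum) (auto simp: qperp_q)
  also have "\<dots> = (\<Sum>m\<in>{1..n}. alt_sign m * q (-1 + m) * qperp m (q n))"
    by (rule sum.mono_neutral_right) (auto simp: n)
  also have "\<dots> = (\<Sum>j=0..int k. - 2 * (alt_sign j * (q j * q (int k - j))))"
    by (rule sum.reindex_bij_witness[of _ "\<lambda>j. j + 1" "\<lambda>m. m - 1"])
       (auto simp: n qperp_q cayley_coeff_def algebra_simps)
  also have "\<dots> = (if n = 1 then - 2 else 0)"
    by (simp flip: sum_distrib_left add: sum_q_alternating n del: mult_minus_left)
  finally show ?thesis .
next
  case False
  have "vertex (-1) (q n) = (\<Sum>m\<in>{0}. alt_sign m * q (-1 + m) * qperp m (q n))"
    by (rule vertex_eq_sum) (use False in \<open>auto simp: qperp_q\<close>)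
  then show ?thesis using False by simp
qed

text \<open>By two instances of \<open>vertex_q_mult\<close> at \<open>F = 1\<close>, the left side
  changes sign when \<open>(p, s)\<close> becomes \<open>(p + 1, s - 1)\<close>. It is therefore
  determined by its value at one point of each diagonal.\<close>

lemma vertex_q_anticommute: "vertex p (q s) + vertex s (q p) = clifford_const p s"
proof -
  define t where "t p s = vertex p (q s) + vertex s (q p)" for p s
  have step: "t p s = - t (p + 1) (s - 1)" for p s
    by (rule eq_if_diff_eq[OF vertex_q_mult[OF Gamma_1, of p s]
          vertex_q_mult[OF Gamma_1, of "s - 1" "p + 1"]]) (simp add: t_def vertex_1 algebra_simps)
  have "t p s = alt_sign k * t (p + k) (s - k)" for k
  proof (induction k rule: int_induct[where k = 0])
    case (step1 i)
    then show ?case using step[of "p + i" "s - i"] by (simp add: algebra_simps)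
  next
    case (step2 i)
    then show ?case using step[of "p + (i - 1)" "s - (i - 1)"] by (simp add: algebra_simps)
  qed auto
  \<comment> \<open>The choice \<open>k = s + 1\<close> moves the second index to -1, where
    \<open>q (-1) = 0\<close> leaves a single term.\<close>
  from this[of "s + 1"] have *: "t p s = - alt_sign s * vertex (-1) (q (p + s + 1))"
    by (simp add: t_def add.assoc)
  show ?thesis
  proof (cases "p + s = 0")
    case True
    then have "p = - s" by simp
    then show ?thesis using * by (simp add: t_def vertex_minus_1_q clifford_const_def)
  next
    case False
    then show ?thesis using * by (simp add: t_def vertex_minus_1_q clifford_const_def)
  qed
qed

text \<open>Two uses of \<open>vertex_q_mult\<close>, for \<open>\<phi>(z)\<close> and
  \<open>\<phi>(u)\<close>. The multipliers \<open>(1 + w/z) (1 + w/u)\<close> and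
  \<open>(1 - w/z) (1 - w/u)\<close> are symmetric in \<open>z\<close> and \<open>u\<close>, so the
  relation can be added to its exchanged form.\<close>

lemma vertex_vertex_q_mult:
  assumes F: "F \<in> Gamma"
  shows "vertex p (vertex r (q s * F)) + vertex (p + 1) (vertex r (q (s - 1) * F))
    + vertex p (vertex (r + 1) (q (s - 1) * F)) + vertex (p + 1) (vertex (r + 1) (q (s - 2) * F))
    = q s * vertex p (vertex r F) - q (s - 1) *
      (vertex (p + 1) (vertex r F) + vertex p (vertex (r + 1) F))
      + q (s - 2) * vertex (p + 1) (vertex (r + 1) F)"
proof -
  have G: "q k * G \<in> Gamma" if "G \<in> Gamma" for k G
    using that by (intro Gamma_mult) auto
  have s: "s - 1 - 1 = s - 2" by simp
  have 1: "vertex a (vertex r (q k * F)) + vertex a (vertex (r + 1) (q (k - 1) * F))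
    = vertex a (q k * vertex r F) - vertex a (q (k - 1) * vertex (r + 1) F)" for a k
    using arg_cong[OF vertex_q_mult[OF F, of r k], of "vertex a"]
    by (simp add: vertex_add vertex_diff G F)
  have "vertex p (vertex r (q s * F)) + vertex p (vertex (r + 1) (q (s - 1) * F))
      + (vertex (p + 1) (vertex r (q (s - 1) * F)) + vertex (p + 1) (vertex (r + 1) (q (s - 2) * F)))
    = vertex p (q s * vertex r F) - vertex p (q (s - 1) * vertex (r + 1) F)
      + (vertex (p + 1) (q (s - 1) * vertex r F) - vertex (p + 1) (q (s - 2) * vertex (r + 1) F))"
    using 1[of p s] 1[of "p + 1" "s - 1"] by (simp only: s)
  moreover have "vertex p (q s * vertex r F) + vertex (p + 1) (q (s - 1) * vertex r F)
      - (vertex p (q (s - 1) * vertex (r + 1) F) + vertex (p + 1) (q (s - 2) * vertex (r + 1) F))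
    = q s * vertex p (vertex r F) - q (s - 1) * vertex (p + 1) (vertex r F)
      - (q (s - 1) * vertex p (vertex (r + 1) F) - q (s - 2) * vertex (p + 1) (vertex (r + 1) F))"
    using vertex_q_mult[of "vertex r F" p s] vertex_q_mult[of "vertex (r + 1) F" p "s - 1"] F
      by (simp add: s)
  ultimately show ?thesis
    by (rule eq_if_diff_eq) (simp add: algebra_simps)
qed

text \<open>In the symmetrised form of \<open>vertex_vertex_q_mult\<close> the two middle terms
  cancel, since \<open>clifford_const (p + 1) r\<close> and \<open>clifford_const p (r + 1)\<close>
  are opposite, and the terms with \<open>q (s - 2)\<close> are the same on both sides.\<close>

lemma vertex_anticommute:
  assumes "F \<in> Gamma"
  shows "vertex p (vertex r F) + vertex r (vertex p F) = clifford_const p r * F"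
  using assms
proof (induction F arbitrary: p r rule: Gamma_q_induct)
  case one
  then show ?case by (simp add: vertex_1 vertex_q_anticommute)
next
  case (add F G)
  show ?case
    by (rule eq_if_diff_eq[OF add.IH(1)[of p r] add.IH(2)[of p r]])
       (simp add: vertex_add add.hyps algebra_simps)
next
  case (uminus F)
  then show ?case by (simp add: vertex_uminus flip: uminus.IH)
next
  case (q k F)
  note F = \<open>F \<in> Gamma\<close>
  have "vertex p (vertex r (q s * F)) + vertex r (vertex p (q s * F))
    = clifford_const p r * (q s * F)" for s
  \<comment> \<open>The recurrence reaches back to \<open>s - 2\<close>, hence the measure
    \<open>s + 2\<close>; for \<open>s < 0\<close> both sides are 0.\<close>
  proof (induction "nat (s + 2)" arbitrary: s p r rule: less_induct)
    case less
    show ?case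
    proof (cases "s < 0")
      case False
      have c: "clifford_const (p + 1) r + clifford_const p (r + 1) = 0"
        by (auto simp: clifford_const_def)
      let ?Y = "\<lambda>p r s. vertex p (vertex r (q s * F)) + vertex r (vertex p (q s * F))"
      let ?Z = "\<lambda>p r. vertex p (vertex r F) + vertex r (vertex p F)"
      have "?Y p r s + (?Y (p + 1) r (s - 1) + ?Y p (r + 1) (s - 1)) + ?Y (p + 1) (r + 1) (s - 2)
        = q s * ?Z p r - q (s - 1) * (?Z (p + 1) r + ?Z p (r + 1)) + q (s - 2) * ?Z (p + 1) (r + 1)"
        by (rule eq_if_diff_eq[OF vertex_vertex_q_mult[OF F, of p r s]
          vertex_vertex_q_mult[OF F, of r p s]])
           (simp add: algebra_simps)
      moreover have "?Y (p + 1) r (s - 1) = clifford_const (p + 1) r * (q (s - 1) * F)"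
        "?Y p (r + 1) (s - 1) = clifford_const p (r + 1) * (q (s - 1) * F)"
        "?Y (p + 1) (r + 1) (s - 2) = clifford_const (p + 1) (r + 1) * (q (s - 2) * F)"
        by (intro less; use False in simp)+
      moreover from this have "?Y (p + 1) r (s - 1) + ?Y p (r + 1) (s - 1) = 0"
        by (simp only: c flip: distrib_right) simp
      moreover have "?Z (p + 1) r + ?Z p (r + 1) = 0"
        unfolding q.IH by (simp add: c flip: distrib_right)
      ultimately show ?thesis
        by (simp only: q.IH mult.left_commute[of "q _"])
          (simp only: mult_zero_right add_0_right diff_zero add_right_cancel)
    qed simp
  qed
  then show ?case .
qed

section \<open>The Pfaffian expansion\<close>

primrec vertex_word :: "int list \<Rightarrow> ipser" where
  "vertex_word [] = 1"
| "vertex_word (p # l) = vertex p (vertex_word l)"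

lemma vertex_word_Gamma [simp]: "vertex_word l \<in> Gamma"
  by (induction l) auto

text \<open>\<open>removal_sum h g l = \<Sum>\<^sub>j (-1)\<^sup>j h(l\<^sub>j) g(l without l\<^sub>j)\<close>, the shape of a Pfaffian expansion.\<close>

fun removal_sum :: "(int \<Rightarrow> ipser) \<Rightarrow> (int list \<Rightarrow> ipser) \<Rightarrow> int list \<Rightarrow> ipser" where
  "removal_sum h g [] = 0"
| "removal_sum h g (p # l) = h p * g l - removal_sum h (\<lambda>l. g (p # l)) l"

lemma removal_sum_cong:
  assumes "\<And>x. x \<in> set l \<Longrightarrow> h x = h' x"
    and "\<And>l'. Suc (length l') = length l \<Longrightarrow> set l' \<subseteq> set l \<Longrightarrow> g l' = g' l'"
  shows "removal_sum h g l = removal_sum h' g' l"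
  using assms
proof (induction l arbitrary: g g')
  case (Cons p l)
  have "removal_sum h (\<lambda>l. g (p # l)) l = removal_sum h' (\<lambda>l. g' (p # l)) l"
    by (intro Cons.IH Cons.prems) auto
  then show ?case using Cons.prems(1)[of p] Cons.prems(2)[of l] by (simp add: subset_insertI)
qed simp

lemma removal_sum_0 [simp]: "removal_sum (\<lambda>_. 0) g l = 0"
  by (induction l arbitrary: g) auto

lemma removal_sum_add: "removal_sum h (\<lambda>l. g l + g' l) l = removal_sum h g l + removal_sum h g' l"
  by (induction l arbitrary: g g') (auto simp: algebra_simps)

lemma removal_sum_mult: "removal_sum h (\<lambda>l. c * g l) l = c * removal_sum h g l"
  by (induction l arbitrary: g) (auto simp: algebra_simps)

lemma removal_sum_zero_right [simp]: "removal_sum h (\<lambda>l. 0) l = 0"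
  using removal_sum_mult[of h 0] by simp

lemma removal_sum_sum: "removal_sum h (\<lambda>l. \<Sum>a\<in>A. g a l) l = (\<Sum>a\<in>A. removal_sum h (g a) l)"
  by (induction A rule: infinite_finite_induct) (auto simp: removal_sum_add)

lemma removal_sum_sum_left: "removal_sum (\<lambda>x. \<Sum>a\<in>A. c a * h a x) g l
  = (\<Sum>a\<in>A. c a * removal_sum (h a) g l)"
  by (induction l arbitrary: g)
     (auto simp: sum_distrib_left sum_distrib_right sum_subtractf right_diff_distrib mult.assoc)

text \<open>Removing the same two letters in the other order changes the sign, because removing the
  earlier letter moves the later one by one place.\<close>

lemma removal_sum_removal_sum: "removal_sum h (removal_sum h' g) l
  = - removal_sum h' (removal_sum h g) l"
proof (induction l arbitrary: g)
  case (Cons p l)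
  have neg: "removal_sum h (\<lambda>l. c * g l - g' l) l
    = c * removal_sum h g l - removal_sum h g' l" for h c g g'
    using removal_sum_add[of h "\<lambda>l. c * g l" "\<lambda>l. -1 * g' l" l] unfolding removal_sum_mult by simp
  show ?case
    unfolding removal_sum.simps neg using Cons.IH[of "\<lambda>l. g (p # l)"] by (simp add: algebra_simps)
qed simp

lemma removal_sum_eq_sum:
  "removal_sum h g l = (\<Sum>j<length l. (-1) ^ j * h (l ! j) * g (take j l @ drop (Suc j) l))"
  by (induction l arbitrary: g)
     (simp_all add: sum.lessThan_Suc_shift sum_negf del: sum.lessThan_Suc)

lemma removal_sum_Gamma:
  "(\<And>x. h x \<in> Gamma) \<Longrightarrow> (\<And>l. g l \<in> Gamma) \<Longrightarrow> removal_sum h g l \<in> Gamma"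
  by (induction l arbitrary: g) (auto intro!: Gamma_diff Gamma_mult)

text \<open>\<open>vertex_q_mult\<close> applied to each removed letter. The result has the shape of
  \<open>qperp_vertex\<close>, with removal sums in place of \<open>qperp\<close>.\<close>

lemma vertex_removal_sum:
  assumes "\<And>l. g l \<in> Gamma"
  shows "vertex p (removal_sum (\<lambda>x. q (x - n)) g l)
    + vertex (p - 1) (removal_sum (\<lambda>x. q (x - (n - 1))) g l)
    = removal_sum (\<lambda>x. q (x - (n - 1))) (\<lambda>l. vertex (p - 1) (g l)) l
      - removal_sum (\<lambda>x. q (x - n)) (\<lambda>l. vertex p (g l)) l"
  using assms
proof (induction l arbitrary: g)
  case (Cons r l)
  have "removal_sum (\<lambda>x. q (x - k)) (\<lambda>l. g (r # l)) l \<in> Gamma" for k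
    by (intro removal_sum_Gamma Cons.prems) auto
  moreover have "q k * g l \<in> Gamma" for k
    by (intro Gamma_mult Cons.prems) auto
  ultimately have vertex: "vertex p (q k * g l - removal_sum (\<lambda>x. q (x - n)) (\<lambda>l. g (r # l)) l)
      = vertex p (q k * g l) - vertex p (removal_sum (\<lambda>x. q (x - n)) (\<lambda>l. g (r # l)) l)" for p k n
    by (simp add: vertex_diff)
  have "r - (n - 1) - 1 = r - n" by simp
  then have "vertex (p - 1) (q (r - (n - 1)) * g l) + vertex p (q (r - n) * g l)
    = q (r - (n - 1)) * vertex (p - 1) (g l) - q (r - n) * vertex p (g l)"
    using vertex_q_mult[of "g l" "p - 1" "r - (n - 1)"] Cons.prems by simp
  moreover note Cons.IH[of "\<lambda>l. g (r # l)", OF Cons.prems, symmetric]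
  ultimately show ?case
    unfolding removal_sum.simps vertex by (rule eq_if_diff_eq) (simp add: algebra_simps)
qed simp

text \<open>A new variable multiplies \<open>\<phi>(z_1) ... \<phi>(z_k) 1\<close> by the product of
  the \<open>(1 + y z_i) / (1 - y z_i)\<close>. In partial fractions, the pole at
  \<open>y = 1 / z_i\<close> accounts for the removal of letter \<open>i\<close>, and the value
  \<open>(-1)^k\<close> at infinity for the extra term at \<open>n = 0\<close>.\<close>

lemma qperp_vertex_word:
  assumes "n \<ge> 0"
  shows "qperp n (vertex_word l) = 2 * removal_sum (\<lambda>x. q (x - n)) vertex_word l
    + (if n = 0 then alt_sign (int (length l)) * vertex_word l else 0)"
  using assms
proof (induction l arbitrary: n rule: length_induct)
  case (1 l)
  let ?h = "\<lambda>n x. q (x - n)"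
  show ?case
  proof (cases l)
    case Nil
    then show ?thesis by (simp add: qperp_1)
  next
    case (Cons p0 \<mu>)
    define e where "e = alt_sign (int (length \<mu>))"
    have ee: "e * e = 1" by (simp add: e_def alt_sign_def)
    have IH: "qperp n (vertex_word l') = 2 * removal_sum (?h n) vertex_word l'
      + (if n = 0 then alt_sign (int (length l')) * vertex_word l' else 0)"
      if "length l' \<le> length \<mu>" "n \<ge> 0" for l' n
      using 1(1) that Cons by auto
    \<comment> \<open>This is the case \<open>n = 0\<close>. Expanding \<open>vertex p\<close> by
      the induction hypothesis produces double removal sums; exchanging them puts the sum with
      \<open>?h 0\<close> inside, where \<open>R0\<close> evaluates it.\<close>
    have base: "vertex p (vertex_word \<mu>) = 2 * removal_sum (?h 0) vertex_word (p # \<mu>)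
      - e * vertex p (vertex_word \<mu>)" for p
    proof -
      \<comment> \<open>Past the largest letter every \<open>q (x - m)\<close> is 0, so sums over
        \<open>m\<close> stop at \<open>N\<close>; the inserted 0 keeps the term
        \<open>m = 0\<close>.\<close>
      define N where "N = Max (insert 0 (set \<mu>))"
      have N: "0 \<le> N" "\<And>x. x \<in> set \<mu> \<Longrightarrow> x \<le> N" by (auto simp: N_def)
      define X where "X l' =
        (\<Sum>m=0..N. (alt_sign m * q (p + m)) * removal_sum (?h m) vertex_word l')" for l'
      have vertex: "vertex p (vertex_word l')
        = 2 * X l' + alt_sign (int (length l')) * q p * vertex_word l'"
        if l': "length l' \<le> length \<mu>" "set l' \<subseteq> set \<mu>" for l'
      proof -
        have "qperp m (vertex_word l') = 0" if "m \<notin> {0..N}" for m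
        proof (cases "m < 0")
          case False
          have "removal_sum (?h m) vertex_word l' = removal_sum (\<lambda>_. 0) vertex_word l'"
            using that False N l'(2) by (intro removal_sum_cong) fastforce+
          then show ?thesis using IH[OF l'(1), of m] False that N(1) by simp
        qed simp
        then have "vertex p (vertex_word l')
          = (\<Sum>m=0..N. alt_sign m * q (p + m) * qperp m (vertex_word l'))"
          by (intro vertex_eq_sum) auto
        also have "\<dots> = (\<Sum>m=0..N. 2 * ((alt_sign m * q (p + m)) * removal_sum (?h m) vertex_word l')
            + (if m = 0 then alt_sign (int (length l')) * q p * vertex_word l' else 0))"
          by (intro sum.cong refl) (simp add: IH l' algebra_simps)
        finally show ?thesis
          using N(1) by (simp add: X_def sum.distrib sum_distrib_left)
      qed
      have R0: "2 * removal_sum (?h 0) vertex_word l'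
        = vertex_word l' - alt_sign (int (length l')) * vertex_word l'"
        if "length l' \<le> length \<mu>" for l'
        using IH[OF that, of 0] by (simp add: qperp_0_id eq_diff_eq)
      have sgn: "alt_sign (int (length l')) = - e" if "Suc (length l') = length \<mu>" for l'
        by (simp add: e_def flip: that)
      have "2 * removal_sum (?h 0) (\<lambda>l'. vertex p (vertex_word l')) \<mu>
        = 2 * removal_sum (?h 0) (\<lambda>l'. 2 * X l' + (- e * q p) * vertex_word l') \<mu>"
        by (intro arg_cong[of _ _ "\<lambda>x. 2 * x"] removal_sum_cong) (auto simp: vertex sgn)
      also have "\<dots> = 2 *
        (\<Sum>m=0..N. (alt_sign m * q (p + m)) *
          (2 * removal_sum (?h 0) (removal_sum (?h m) vertex_word) \<mu>))
          - e * q p * (2 * removal_sum (?h 0) vertex_word \<mu>)"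
        unfolding removal_sum_add removal_sum_mult unfolding X_def removal_sum_sum removal_sum_mult
        by (simp add: distrib_left sum_distrib_left ac_simps)
      also have "(\<Sum>m=0..N. (alt_sign m * q (p + m)) *
        (2 * removal_sum (?h 0) (removal_sum (?h m) vertex_word) \<mu>))
        = (\<Sum>m=0..N. (alt_sign m * q (p + m)) * (- (1 + e) * removal_sum (?h m) vertex_word \<mu>))"
      proof (rule sum.cong[OF refl])
        fix m
        have "2 * removal_sum (?h 0) (removal_sum (?h m) vertex_word) \<mu>
          = - removal_sum (?h m) (\<lambda>l'. 2 * removal_sum (?h 0) vertex_word l') \<mu>"
          unfolding removal_sum_mult removal_sum_removal_sum[of "?h 0" "?h m"] by simp
        also have "removal_sum (?h m) (\<lambda>l'. 2 * removal_sum (?h 0) vertex_word l') \<mu>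
          = removal_sum (?h m) (\<lambda>l'. (1 + e) * vertex_word l') \<mu>"
          by (intro removal_sum_cong refl) (subst R0, simp_all add: sgn algebra_simps)
        finally have "2 * removal_sum (?h 0) (removal_sum (?h m) vertex_word) \<mu>
          = - (1 + e) * removal_sum (?h m) vertex_word \<mu>"
          unfolding removal_sum_mult by (simp add: algebra_simps)
        then show "alt_sign m * q (p + m) * (2 * removal_sum (?h 0) (removal_sum (?h m) vertex_word) \<mu>)
          = alt_sign m * q (p + m) * (- (1 + e) * removal_sum (?h m) vertex_word \<mu>)" by (simp only:)
      qed
      also have "\<dots> = - (1 + e) * X \<mu>"
        by (simp add: X_def sum_distrib_left ac_simps)
      also have "2 * (- (1 + e) * X \<mu>)
        = - (1 + e) * (vertex p (vertex_word \<mu>) - e * q p * vertex_word \<mu>)"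
        by (simp add: vertex e_def)
      also have "2 * removal_sum (?h 0) vertex_word \<mu> = vertex_word \<mu> - e * vertex_word \<mu>"
        unfolding e_def by (rule R0) simp
      finally have "2 * removal_sum (?h 0) (\<lambda>l'. vertex p (vertex_word l')) \<mu>
        = - (1 + e) * vertex p (vertex_word \<mu>) + (e + (e * e) - e + (e * e)) * q p * vertex_word \<mu>"
        by (simp add: algebra_simps)
      then show ?thesis
        unfolding ee by (simp add: algebra_simps)
    qed
    \<comment> \<open>Both sides obey one recurrence that lowers \<open>n\<close> and
      \<open>p\<close> together, so \<open>base\<close> for all \<open>p\<close> is a sufficient
      start.\<close>
    have "qperp (int k) (vertex_word (p # \<mu>)) = 2 * removal_sum (?h (int k)) vertex_word (p # \<mu>)
      + (if int k = 0 then alt_sign (int (length (p # \<mu>))) * vertex_word (p # \<mu>) else 0)" for k p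
    proof (induction k arbitrary: p)
      case 0
      then show ?case using base[of p] by (simp add: qperp_0_id e_def)
    next
      case (Suc k)
      let ?n = "int (Suc k)"
      have n: "?n - 1 = int k" by simp
      have Sg: "removal_sum (?h m) vertex_word \<mu> \<in> Gamma" for m
        by (intro removal_sum_Gamma) auto
      have c: "vertex p (2 * F) = 2 * vertex p F" 
        "vertex p (e * F) = e * vertex p F" if "F \<in> Gamma" for p F
        using that by (simp_all only: mult_2 vertex_add) (simp add: e_def alt_sign_def vertex_uminus)
      have "2 \<in> Gamma" using Gamma_of_int[of 2] by simp
      then have S2: "2 * removal_sum (?h m) vertex_word \<mu> \<in> Gamma" "e * vertex_word \<mu> \<in> Gamma" for m
        using Sg[of m] by (auto simp: e_def intro!: Gamma_mult)
      have "vertex p (qperp ?n (vertex_word \<mu>)) = vertex p (2 * removal_sum (?h ?n) vertex_word \<mu>)"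
        by (subst IH) auto
      then have 1: "vertex p (qperp ?n (vertex_word \<mu>))
        = 2 * vertex p (removal_sum (?h ?n) vertex_word \<mu>)"
        by (simp only: c(1) Sg)
      have "vertex (p - 1) (qperp (int k) (vertex_word \<mu>))
        = vertex (p - 1) (2 * removal_sum (?h (int k)) vertex_word \<mu>
          + (if k = 0 then e * vertex_word \<mu> else 0))"
        by (subst IH) (auto simp: e_def)
      then have 2: "vertex (p - 1) (qperp (int k) (vertex_word \<mu>))
        = 2 * vertex (p - 1) (removal_sum (?h (int k)) vertex_word \<mu>)
          + (if k = 0 then e * vertex (p - 1) (vertex_word \<mu>) else 0)"
        using vertex_add[OF S2] c(1)[OF Sg] c(2)[OF vertex_word_Gamma]
          by (cases "k = 0") (simp_all only: if_True if_False add_0_right simp_thms)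
      have 3: "qperp (int k) (vertex (p - 1) (vertex_word \<mu>))
        = 2 * removal_sum (?h (int k)) vertex_word ((p - 1) # \<mu>)
        - (if k = 0 then e * vertex (p - 1) (vertex_word \<mu>) else 0)"
        using Suc.IH[of "p - 1"] by (simp add: e_def)
      have pn: "p - ?n = p - 1 - int k" by simp
      have "qperp ?n (vertex p (vertex_word \<mu>)) = qperp (int k) (vertex (p - 1) (vertex_word \<mu>))
          + (vertex p (qperp ?n (vertex_word \<mu>)) + vertex (p - 1) (qperp (int k) (vertex_word \<mu>)))"
        using qperp_vertex[of "vertex_word \<mu>" ?n p] unfolding n by (simp add: diff_eq_eq add.commute)
      also have "\<dots> = 2 * (removal_sum (?h (int k)) vertex_word ((p - 1) # \<mu>)
        + (vertex p (removal_sum (?h ?n) vertex_word \<mu>)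
          + vertex (p - 1) (removal_sum (?h (int k)) vertex_word \<mu>)))"
        unfolding 1 2 3 by (simp only: distrib_left) simp
      also have "vertex p (removal_sum (?h ?n) vertex_word \<mu>)
        + vertex (p - 1) (removal_sum (?h (int k)) vertex_word \<mu>)
        = removal_sum (?h (int k)) (\<lambda>l. vertex (p - 1) (vertex_word l)) \<mu>
          - removal_sum (?h ?n) (\<lambda>l. vertex p (vertex_word l)) \<mu>"
        using vertex_removal_sum[of vertex_word p ?n \<mu>] unfolding n by simp
      finally show ?case
        by (simp only: removal_sum.simps vertex_word.simps pn) simp
    qed
    from this[of "nat n" p0] show ?thesis using Cons 1(2) by simp
  qed
qed

text \<open>Beyond \<open>m = x\<close> the factor \<open>q (x - m)\<close> vanishes, so one bound
  \<open>N\<close> serves all letters of a word.\<close>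

lemma Q2_eq_sum:
  assumes "x \<le> N" "0 \<le> N"
  shows "Q2 p x = (\<Sum>m=0..N. (alt_sign m * (if m = 0 then 1 else 2) * q (p + m)) * q (x - m))"
proof -
  let ?f = "\<lambda>m. (alt_sign m * (if m = 0 then 1 else 2) * q (p + m)) * q (x - m)"
  have "(\<Sum>m=0..N. ?f m) = q p * q x + (\<Sum>m=1..N. ?f m)"
    using assms(2) by (subst sum.remove[of _ 0]) (auto intro!: sum.cong)
  also have "(\<Sum>m=1..N. ?f m) = (\<Sum>m=1..x. ?f m)"
    by (rule sum.mono_neutral_right) (use assms in auto)
  also have "\<dots> = (\<Sum>m=1..x. 2 * ((-1) ^ nat m * q (p + m) * q (x - m)))"
    by (intro sum.cong refl) (auto simp: alt_sign_def minus_one_power_iff even_nat_iff)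
  finally show ?thesis by (simp add: Q2_def sum_distrib_left)
qed

text \<open>For odd length, \<open>qperp_vertex_word\<close> at \<open>n = 0\<close> says that the
  removal sum is the word itself. So the removal sums carry the factor 1 for \<open>m = 0\<close>
  and 2 for \<open>m > 0\<close>, just as in \<open>Q2_eq_sum\<close>.\<close>

lemma vertex_word_Cons_eq_removal_sum:
  assumes "odd (length \<mu>)"
  shows "vertex_word (p # \<mu>) = removal_sum (Q2 p) vertex_word \<mu>"
proof -
  define N where "N = Max (insert 0 (set \<mu>))"
  have N: "0 \<le> N" "\<And>x. x \<in> set \<mu> \<Longrightarrow> x \<le> N" by (auto simp: N_def)
  let ?h = "\<lambda>n x. q (x - n)"
  have alt_sign: "alt_sign (int (length \<mu>)) = -1" using assms by (simp add: alt_sign_def)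
  have "2 * removal_sum (?h 0) vertex_word \<mu> = 2 * vertex_word \<mu>"
    using qperp_vertex_word[of 0 \<mu>] by (simp add: qperp_0_id alt_sign eq_diff_eq)
  then have R0: "removal_sum (?h 0) vertex_word \<mu> = vertex_word \<mu>" by (rule ipser_2_cancel)
  have DR: "qperp m (vertex_word \<mu>) = (if m = 0 then 1 else 2) * removal_sum (?h m) vertex_word \<mu>" if
    "m \<ge> 0" for m
    using qperp_vertex_word[OF that, of \<mu>] R0 by (auto simp: qperp_0_id)
  have "qperp m (vertex_word \<mu>) = 0" if "m \<notin> {0..N}" for m
  proof (cases "m < 0")
    case False
    have "removal_sum (?h m) vertex_word \<mu> = removal_sum (\<lambda>_. 0) vertex_word \<mu>"
      using that False N(2) by (intro removal_sum_cong) fastforce+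
    then show ?thesis using DR[of m] False by simp
  qed simp
  then have "vertex_word (p # \<mu>) = (\<Sum>m=0..N. alt_sign m * q (p + m) * qperp m (vertex_word \<mu>))"
    by (simp only: vertex_word.simps) (intro vertex_eq_sum, auto)
  also have "\<dots> = (\<Sum>m=0..N. (alt_sign m * (if m = 0 then 1 else 2) * q (p + m)) * removal_sum
    (?h m) vertex_word \<mu>)"
    by (intro sum.cong refl) (simp add: DR)
  also have "\<dots> = removal_sum
    (\<lambda>x. \<Sum>m=0..N. (alt_sign m * (if m = 0 then 1 else 2) * q (p + m)) * q (x - m)) vertex_word \<mu>"
    by (rule removal_sum_sum_left[symmetric])
  also have "\<dots> = removal_sum (Q2 p) vertex_word \<mu>"
    by (intro removal_sum_cong refl) (simp add: Q2_eq_sum[OF N(2) N(1)])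
  finally show ?thesis .
qed

lemma mat_delete_Qmat:
  assumes "k < length \<mu>"
  shows "mat_delete (mat_delete (Qmat (p # \<mu>)) (Suc k) (Suc k)) 0 0
    = Qmat (take k \<mu> @ drop (Suc k) \<mu>)"
proof (rule eq_matI)
  fix i j
  assume "i < dim_row (Qmat (take k \<mu> @ drop (Suc k) \<mu>))"
    "j < dim_col (Qmat (take k \<mu> @ drop (Suc k) \<mu>))"
  with assms have ij: "i < length \<mu> - 1" "j < length \<mu> - 1" by (auto simp: Qmat_def)
  let ?s = "\<lambda>i. if i < k then i else Suc i"
  have nth: "(take k \<mu> @ drop (Suc k) \<mu>) ! i = \<mu> ! ?s i" if "i < length \<mu> - 1" for i
    using that assms by (auto simp: nth_append min_def)
  show "mat_delete (mat_delete (Qmat (p # \<mu>)) (Suc k) (Suc k)) 0 0 $$ (i, j)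
    = Qmat (take k \<mu> @ drop (Suc k) \<mu>) $$ (i, j)"
    using ij assms by (auto simp: mat_delete_def Qmat_def nth simp del: nth_append)
qed (use assms in \<open>auto simp: Qmat_def mat_delete_def\<close>)

text \<open>The expansion along the first row and the one along the first letter agree term by term;
  with \<open>j = k + 1\<close> their signs coincide.\<close>

lemma pfaffian_Qmat: "even (length l) \<Longrightarrow> pfaffian (Qmat l) = vertex_word l"
proof (induction l rule: length_induct)
  case (1 l)
  show ?case
  proof (cases l)
    case Nil
    then show ?thesis by (subst pfaffian.simps) (simp add: Qmat_def)
  next
    case (Cons p \<mu>)
    have dim: "dim_row (Qmat l) = Suc (length \<mu>)" by (simp add: Qmat_def Cons)
    have "pfaffian (Qmat l) = (\<Sum>j = 1..<Suc (length \<mu>). (-1) ^ (j + 1) * Qmat l $$ (0, j)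
        * pfaffian (mat_delete (mat_delete (Qmat l) j j) 0 0))"
      by (subst pfaffian.simps) (simp only: dim Suc_not_Zero if_False)
    also have "\<dots> = (\<Sum>k<length \<mu>. (-1) ^ k * Q2 p (\<mu> ! k) * vertex_word (take k \<mu> @ drop (Suc k) \<mu>))"
    proof (rule sum.reindex_bij_witness[of _ Suc "\<lambda>j. j - 1"])
      fix j assume j: "j \<in> {1..<Suc (length \<mu>)}"
      then obtain k where k: "j = Suc k" "k < length \<mu>" by (cases j) auto
      have "pfaffian (Qmat (take k \<mu> @ drop (Suc k) \<mu>)) = vertex_word (take k \<mu> @ drop (Suc k) \<mu>)"
        using 1 k Cons by auto
      then show "(-1) ^ (j - 1) * Q2 p (\<mu> ! (j - 1)) * vertex_word
        (take (j - 1) \<mu> @ drop (Suc (j - 1)) \<mu>)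
        = (-1) ^ (j + 1) * Qmat l $$ (0, j) * pfaffian (mat_delete (mat_delete (Qmat l) j j) 0 0)"
        using k by (simp add: Cons mat_delete_Qmat) (simp add: Qmat_def)
    qed auto
    also have "\<dots> = vertex_word l"
      using 1(2) Cons by (simp add: vertex_word_Cons_eq_removal_sum removal_sum_eq_sum del:
        vertex_word.simps)
    finally show ?thesis .
  qed
qed

text \<open>Padding with a zero is harmless because \<open>vertex 0 1 = q 0 = 1\<close>.\<close>

lemma Qfun_eq_vertex_word: "Qfun l = vertex_word l"
proof -
  have "vertex_word (l @ [0]) = vertex_word l" by (induction l) (auto simp: vertex_1)
  then show ?thesis by (simp add: Qfun_def pfaffian_Qmat)
qed

lemma icoeff_alt_sign_mult: "icoeff (alt_sign n * F) m = (if even n then 1 else -1) * icoeff F m"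
  by (simp add: alt_sign_def uminus_ipser.rep_eq)

lemma icoeff_vertex:
  assumes "G \<in> Gamma"
  shows "icoeff (vertex p G) 0 = icoeff (alt_sign p * qperp (- p) G) 0"
proof -
  obtain N where N: "\<And>n. n \<notin> {0..N} \<Longrightarrow> qperp n G = 0" using qperp_support[OF assms] by blast
  have "vertex p G = (\<Sum>m\<in>insert (- p) {0..N}. alt_sign m * q (p + m) * qperp m G)"
    by (rule vertex_eq_sum) (auto intro: N)
  then have "icoeff (vertex p G) 0
    = (\<Sum>m\<in>insert (- p) {0..N}. if m = - p then icoeff (alt_sign p * qperp (- p) G) 0 else 0)"
    by (simp only: icoeff_sum)
      (intro sum.cong, auto simp: mult.assoc icoeff_alt_sign_mult icoeff_mult_0 icoeff_q_0)
  then show ?thesis by simp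
qed

section \<open>Orthogonality and adjoints\<close>

definition vertex_adj :: "int \<Rightarrow> ipser \<Rightarrow> ipser" where
  "vertex_adj p G = alt_sign p * vertex (- p) G"

lemma vertex_adj_Gamma [simp]: "G \<in> Gamma \<Longrightarrow> vertex_adj p G \<in> Gamma"
  by (simp add: vertex_adj_def Gamma_mult)

lemma vertex_adj_0 [simp]: "vertex_adj p 0 = 0"
  by (simp add: vertex_adj_def)

lemma vertex_adj_add: "F \<in> Gamma \<Longrightarrow> G \<in> Gamma \<Longrightarrow> vertex_adj p (F + G) = vertex_adj p F + vertex_adj p G"
  by (simp add: vertex_adj_def vertex_add distrib_left)

lemma vertex_adj_uminus: "F \<in> Gamma \<Longrightarrow> vertex_adj p (- F) = - vertex_adj p F"
  by (simp add: vertex_adj_def vertex_uminus)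

lemma vertex_alt_sign_mult: "F \<in> Gamma \<Longrightarrow> vertex p (alt_sign n * F) = alt_sign n * vertex p F"
  by (simp add: alt_sign_def vertex_uminus)

lemma vertex_adj_anticommute:
  assumes "G \<in> Gamma"
  shows "vertex_adj r (vertex_adj p G) + vertex_adj p (vertex_adj r G) = clifford_const p r * G"
proof -
  have "vertex_adj r (vertex_adj p G) + vertex_adj p (vertex_adj r G)
    = alt_sign (p + r) * (vertex (- p) (vertex (- r) G) + vertex (- r) (vertex (- p) G))"
    using assms by (simp add: vertex_adj_def vertex_alt_sign_mult distrib_left add.commute flip:
      mult.assoc)
  then show ?thesis
    using assms by (auto simp: vertex_anticommute clifford_const_def)
qed

lemma vertex_adj_vertex:
  assumes "F \<in> Gamma"
  shows "vertex_adj p (vertex r F) + vertex r (vertex_adj p F) = (if p = r then 2 * F else 0)"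
proof -
  have "vertex_adj p (vertex r F) + vertex r (vertex_adj p F)
    = alt_sign p * (vertex (- p) (vertex r F) + vertex r (vertex (- p) F))"
    using assms by (simp add: vertex_adj_def vertex_alt_sign_mult distrib_left)
  then show ?thesis
    using assms by (auto simp: vertex_anticommute clifford_const_def alt_sign_def)
qed

text \<open>This is \<open>qperp_vertex\<close> at \<open>- p\<close>, arranged as the transpose of
  \<open>vertex_q_mult\<close> solved for \<open>q s * vertex p F\<close>.\<close>

lemma vertex_adj_qperp:
  assumes "G \<in> Gamma"
  shows "vertex_adj p (qperp s G)
    = vertex_adj (p + 1) (qperp (s - 1) G)
      + (qperp s (vertex_adj p G) + qperp (s - 1) (vertex_adj (p + 1) G))"
proof -
  have 1: "vertex_adj (p + 1) F = - (alt_sign p * vertex (- p - 1) F)" for F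
    by (simp add: vertex_adj_def)
  have h: "alt_sign p * (qperp s (vertex (- p) G) - qperp (s - 1) (vertex (- p - 1) G))
    = alt_sign p * (vertex (- p) (qperp s G) + vertex (- p - 1) (qperp (s - 1) G))"
    by (simp only: qperp_vertex[OF assms])
  show ?thesis
    unfolding 1 by (rule eq_if_diff_eq[OF h[symmetric] refl[of 0]])
      (simp add: vertex_adj_def qperp_alt_sign_mult qperp_uminus algebra_simps)
qed

text \<open>\<open>word_form l G\<close> is the inner product of \<open>Q\<^sub>l\<close> and \<open>G\<close>, computed by moving the operators
  \<^const>\<open>vertex\<close> that create \<open>Q\<^sub>l\<close> to the other side.\<close>

primrec word_form :: "int list \<Rightarrow> ipser \<Rightarrow> int" where
  "word_form [] G = icoeff G 0"
| "word_form (p # l) G = word_form l (vertex_adj p G)"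

lemma word_form_Cons: "word_form (p # l) = (\<lambda>G. word_form l (vertex_adj p G))"
  by (rule ext) simp

lemma word_form_0 [simp]: "word_form l 0 = 0"
  by (induction l) (auto simp: zero_ipser.rep_eq)

lemma word_form_add: "F \<in> Gamma \<Longrightarrow> G \<in> Gamma \<Longrightarrow> word_form l (F + G) = word_form l F + word_form l G"
  by (induction l arbitrary: F G) (auto simp: plus_ipser.rep_eq vertex_adj_add)

lemma word_form_uminus: "F \<in> Gamma \<Longrightarrow> word_form l (- F) = - word_form l F"
  by (induction l arbitrary: F) (auto simp: uminus_ipser.rep_eq vertex_adj_uminus)

lemma word_form_diff: "F \<in> Gamma \<Longrightarrow> G \<in> Gamma \<Longrightarrow> word_form l (F - G) = word_form l F - word_form l G"
  using word_form_add[of F "- G" l] by (simp add: Gamma_uminus word_form_uminus)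

lemma word_form_of_int_mult:
  assumes "F \<in> Gamma"
  shows "word_form l (of_int k * F) = k * word_form l F"
proof -
  have nat: "of_nat n * F \<in> Gamma \<and> word_form l (of_nat n * F) = int n * word_form l F" for n
    by (induction n) (auto simp: distrib_right word_form_add assms Gamma_add)
  then show ?thesis
    by (cases k rule: int_cases2) (auto simp: word_form_uminus)
qed

lemma word_form_sum: "(\<And>a. a \<in> A \<Longrightarrow> f a \<in> Gamma) \<Longrightarrow> word_form l (sum f A) = (\<Sum>a\<in>A. word_form l (f a))"
  by (induction A rule: infinite_finite_induct) (auto simp: word_form_add Gamma_sum)

text \<open>The operator anticommutes with every letter other than \<open>p\<close> and kills 1,
  since \<open>q (- p) = 0\<close>.\<close>

lemma vertex_adj_vertex_word_eq_0: "p > 0 \<Longrightarrow> p \<notin> set l \<Longrightarrow> vertex_adj p (vertex_word l) = 0"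
proof (induction l)
  case Nil
  then show ?case by (simp add: vertex_adj_def vertex_1)
next
  case (Cons x l)
  then show ?case using vertex_adj_vertex[of "vertex_word l" p x] by simp
qed

text \<open>The dual statement: \<open>vertex p\<close> moves through all adjoints until its
  constant term is taken, which is 0 for \<open>p > 0\<close>.\<close>

lemma word_form_vertex_eq_0: "p > 0 \<Longrightarrow> p \<notin> set l \<Longrightarrow> F \<in> Gamma \<Longrightarrow> word_form l (vertex p F) = 0"
proof (induction l arbitrary: F)
  case Nil
  then show ?case by (simp add: icoeff_vertex zero_ipser.rep_eq)
next
  case (Cons x l)
  have "vertex_adj x (vertex p F) = - vertex p (vertex_adj x F)"
    using vertex_adj_vertex[of F x p] Cons.prems by (simp add: add_eq_0_iff2)
  then show ?case using Cons by (simp add: word_form_uminus)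
qed

section \<open>Strict partitions and orthogonality\<close>

definition strict_below :: "int \<Rightarrow> int list \<Rightarrow> bool" where
  "strict_below m l \<longleftrightarrow> sorted_wrt (>) l \<and> (\<forall>x\<in>set l. 0 < x \<and> x < m)"

lemma strict_partitions_iff:
  "l \<in> strict_partitions \<longleftrightarrow> sorted_wrt (>) l \<and> (\<forall>x\<in>set l. 0 < x)"
proof -
  have "l \<in> strict_partitions \<longleftrightarrow> sorted_wrt (\<ge>) l \<and> distinct l \<and> (\<forall>x\<in>set l. 0 < x)"
    by (auto simp: strict_partitions_def is_partition_def is_strict_def filter_id_conv order_less_le
        intro: distinct_filter) (metis (mono_tags, lifting) filter_True)
  moreover have "sorted_wrt (\<ge>) l \<and> distinct l \<longleftrightarrow> sorted_wrt (>) l"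
    by (induction l) (auto simp: order_less_le)
  ultimately show ?thesis by blast
qed

lemma strict_below_imp: "strict_below m l \<Longrightarrow> l \<in> strict_partitions"
  by (auto simp: strict_partitions_iff strict_below_def)

lemma strict_partitions_below:
  assumes "l \<in> strict_partitions"
  shows "\<exists>m\<ge>k. strict_below m l"
proof -
  have "strict_below (Max (insert k (set l)) + 1) l"
    using assms by (auto simp: strict_partitions_iff strict_below_def less_le_trans)
  moreover have "k \<le> Max (insert k (set l)) + 1"
    using Max_ge[of "insert k (set l)" k] by (simp del: Max_ge)
  ultimately show ?thesis by blast
qed

text \<open>If the largest parts differ, the larger one is missing on the other side and its
  operator moves through to give 0. If they agree, \<open>vertex_adj_vertex\<close> contributes a
  factor 2 and leaves the tails.\<close>

lemma word_form_vertex_word: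
  assumes "l \<in> strict_partitions" "l' \<in> strict_partitions"
  shows "word_form l (vertex_word l') = (if l = l' then 2 ^ length l else 0)"
  using assms
proof (induction l arbitrary: l')
  case Nil
  then show ?case
    by (cases l') (auto simp: one_ipser.rep_eq strict_partitions_iff icoeff_vertex zero_ipser.rep_eq)
next
  case (Cons x l)
  then have x: "x > 0" "l \<in> strict_partitions" "\<And>y. y \<in> set l \<Longrightarrow> y < x"
    by (auto simp: strict_partitions_iff)
  show ?case
  proof (cases l')
    case Nil
    then show ?thesis using x vertex_adj_vertex_word_eq_0[of x "[]"] by simp
  next
    case (Cons y l'')
    with Cons.prems have y: "y > 0" "l'' \<in> strict_partitions" "\<And>z. z \<in> set l'' \<Longrightarrow> z < y"
      by (auto simp: strict_partitions_iff)
    consider "x = y" | "x < y" | "x > y" by linarith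
    then show ?thesis
    proof cases
      case 1
      have "vertex_adj x (vertex_word l'') = 0"
        using x y 1 by (intro vertex_adj_vertex_word_eq_0) auto
      then have "vertex_adj x (vertex_word l') = of_int 2 * vertex_word l''"
        using vertex_adj_vertex[of "vertex_word l''" x y] 1 Cons by simp
      then show ?thesis
        using Cons.IH[OF x(2) y(2)] 1 Cons
          by (simp only: word_form.simps word_form_of_int_mult vertex_word_Gamma) simp
    next
      case 2
      then have "word_form (x # l) (vertex y (vertex_word l'')) = 0"
        using x y by (intro word_form_vertex_eq_0) fastforce+
      then show ?thesis using 2 Cons by simp
    next
      case 3
      then have "vertex_adj x (vertex_word l') = 0"
        using x y Cons by (intro vertex_adj_vertex_word_eq_0) fastforce+
      then show ?thesis using 3 Cons by simp
    qed
  qed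
qed

text \<open>\<open>pair_span P F \<beta>\<close> means that \<open>(F, \<beta>)\<close> is an integer combination of the pairs
  \<open>(Q\<^sub>l, word_form l)\<close> with \<open>P l\<close>, where functionals that agree on \<open>\<Gamma>\<close> are identified. Rewriting both
  components
  at once shows that a functional is determined by its symmetric function.\<close>

inductive pair_span :: "(int list \<Rightarrow> bool) \<Rightarrow> ipser \<Rightarrow> (ipser \<Rightarrow> int) \<Rightarrow> bool" for P where
  pair_span_0: "pair_span P 0 (\<lambda>_. 0)"
| pair_span_base: "P l \<Longrightarrow> pair_span P (vertex_word l) (word_form l)"
| pair_span_add: "pair_span P F \<beta> \<Longrightarrow> pair_span P G \<gamma> \<Longrightarrow> pair_span P (F + G) (\<lambda>H. \<beta> H + \<gamma> H)"
| pair_span_uminus: "pair_span P F \<beta> \<Longrightarrow> pair_span P (- F) (\<lambda>H. - \<beta> H)"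
| pair_span_cong: "pair_span P F \<beta> \<Longrightarrow> (\<And>H. H \<in> Gamma \<Longrightarrow> \<gamma> H = \<beta> H) \<Longrightarrow> pair_span P F \<gamma>"

section \<open>Straightening words together with their functionals\<close>

lemma pair_span_Gamma: "pair_span P F \<beta> \<Longrightarrow> F \<in> Gamma"
  by (induction rule: pair_span.induct) (auto intro: Gamma_add Gamma_uminus)

lemma pair_span_of_int_mult:
  assumes "pair_span P F \<beta>"
  shows "pair_span P (of_int k * F) (\<lambda>H. k * \<beta> H)"
proof -
  have nat: "pair_span P (of_nat n * F) (\<lambda>H. int n * \<beta> H)" for n
  proof (induction n)
    case (Suc n)
    show ?case using pair_span_add[OF assms Suc] by (simp add: distrib_right)
  qed (simp add: pair_span_0)
  show ?thesis
    using nat pair_span_uminus[OF nat] by (cases k rule: int_cases2) auto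
qed

lemma pair_span_trans:
  assumes "pair_span P F \<beta>" "\<And>l. P l \<Longrightarrow> pair_span P' (vertex_word l) (word_form l)"
  shows "pair_span P' F \<beta>"
  using assms(1)
proof (induction rule: pair_span.induct)
  case (pair_span_cong F \<beta> \<gamma>)
  then show ?case by (auto intro: pair_span.pair_span_cong)
qed (auto intro: pair_span.intros assms(2))

lemma pair_span_vertex:
  assumes "pair_span P F \<beta>" 
    "\<And>l. P l \<Longrightarrow> pair_span P' (vertex p (vertex_word l)) (\<lambda>H. word_form l (vertex_adj p H))"
  shows "pair_span P' (vertex p F) (\<lambda>H. \<beta> (vertex_adj p H))"
  using assms(1)
proof (induction rule: pair_span.induct)
  case pair_span_0
  show ?case using pair_span.pair_span_0[of P'] by simp
next
  case (pair_span_base l)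
  then show ?case by (rule assms(2))
next
  case (pair_span_add F \<beta> G \<gamma>)
  then show ?case by (simp add: vertex_add[OF pair_span_Gamma pair_span_Gamma] pair_span.pair_span_add)
next
  case (pair_span_uminus F \<beta>)
  then show ?case by (simp add: vertex_uminus[OF pair_span_Gamma] pair_span.pair_span_uminus)
next
  case (pair_span_cong F \<beta> \<gamma>)
  show ?case by (rule pair_span.pair_span_cong[OF pair_span_cong.IH]) (simp add: pair_span_cong)
qed

text \<open>The Clifford relations act in parallel on both components: \<open>p > x\<close> is
  strict already, \<open>p = x\<close> gives 0, and \<open>p < x\<close> is exchanged with
  \<open>x\<close>. The bound \<open>m\<close> is what allows \<open>x\<close> to be put back in
  front, as the straightened rest stays below \<open>x\<close>.\<close>

lemma pair_span_vertex_strict_below: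
  "strict_below m l \<Longrightarrow> p < m
    \<Longrightarrow> pair_span (strict_below m) (vertex p (vertex_word l)) (\<lambda>H. word_form l (vertex_adj p H))"
proof (induction l arbitrary: m p)
  case Nil
  consider "p > 0" | "p = 0" | "p < 0" by linarith
  then show ?case
  proof cases
    case 1
    then have "strict_below m [p]" using Nil by (simp add: strict_below_def)
    from pair_span_base[of "strict_below m", OF this] show ?thesis by (simp add: word_form_Cons)
  next
    case 2
    show ?thesis
      by (rule pair_span_cong[of _ _ "word_form []"])
         (use 2 pair_span_base[of "strict_below m" "[]"] Nil in \<open>auto simp: vertex_1 vertex_adj_def icoeff_vertex qperp_0_id\<close>)
  next
    case 3
    show ?thesis
      by (rule pair_span_cong[of _ _ "\<lambda>_. 0"])
         (use 3 in \<open>auto simp: vertex_1 pair_span_0 vertex_adj_def icoeff_vertex icoeff_alt_sign_mult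
           zero_ipser.rep_eq\<close>)
  qed
next
  case (Cons x l)
  then have x: "0 < x" "x < m" "strict_below x l" "strict_below m l"
    by (auto simp: strict_below_def)
  consider "p > x" | "p = x" | "p < x" by linarith
  then show ?case
  proof cases
    case 1
    then have "strict_below m (p # x # l)" using Cons by (auto simp: strict_below_def)
    from pair_span_base[of "strict_below m", OF this] show ?thesis by (simp add: word_form_Cons)
  next
    case 2
    have "2 * vertex x (vertex x (vertex_word l)) = 2 * 0"
      using vertex_anticommute[of "vertex_word l" x x] x(1) by (simp add: clifford_const_def)
    then have "vertex p (vertex_word (x # l)) = 0" using 2 ipser_2_cancel by fastforce
    moreover have "vertex_adj x (vertex_adj p H) = 0" if "H \<in> Gamma" for H
    proof (rule ipser_2_cancel)
      show "2 * vertex_adj x (vertex_adj p H) = 2 * 0"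
        using vertex_adj_anticommute[OF that, of x x] x(1) 2 by (simp add: clifford_const_def)
    qed
    ultimately show ?thesis
      by - (rule pair_span_cong[of _ _ "\<lambda>_. 0"], auto simp: pair_span_0)
  next
    case 3
    obtain k where k: "clifford_const p x = of_int k"
    proof
      show "clifford_const p x = of_int (if p + x = 0 then 2 * (if even p then 1 else -1) else 0)"
        by (simp add: clifford_const_def alt_sign_def)
    qed
    have "pair_span (strict_below m) (vertex x (vertex p (vertex_word l)))
      (\<lambda>H. word_form l (vertex_adj p (vertex_adj x H)))"
    proof (rule pair_span_vertex)
      show "pair_span (strict_below x) (vertex p (vertex_word l)) (\<lambda>H. word_form l (vertex_adj p H))"
        using x 3 by (intro Cons.IH)
      fix l' assume "strict_below x l'"
      then have "strict_below m (x # l')" using x by (auto simp: strict_below_def)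
      from pair_span_base[of "strict_below m", OF this]
      show "pair_span (strict_below m) (vertex x (vertex_word l')) (\<lambda>H. word_form l' (vertex_adj x H))"
        by (simp add: word_form_Cons)
    qed
    from pair_span_add[OF pair_span_of_int_mult[OF pair_span_base[of "strict_below m", OF x(4)], of k]
      pair_span_uminus[OF this]]
    have "pair_span (strict_below m) (of_int k * vertex_word l - vertex x (vertex p (vertex_word l)))
      (\<lambda>H. k * word_form l H - word_form l (vertex_adj p (vertex_adj x H)))" by simp
    also have "of_int k * vertex_word l - vertex x (vertex p (vertex_word l))
      = vertex p (vertex_word (x # l))"
      using vertex_anticommute[of "vertex_word l" p x] by (simp add: k diff_eq_eq)
    finally show ?thesis
    proof (rule pair_span_cong)
      fix H assume H: "H \<in> Gamma"
      have "vertex_adj x (vertex_adj p H) = of_int k * H - vertex_adj p (vertex_adj x H)"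
        using vertex_adj_anticommute[OF H, of x p] by (simp add: k eq_diff_eq)
      then show "word_form (x # l) (vertex_adj p H)
        = k * word_form l H - word_form l (vertex_adj p (vertex_adj x H))"
        using H by (simp add: word_form_diff word_form_of_int_mult Gamma_mult Gamma_of_int)
    qed
  qed
qed

abbreviation "strict_span \<equiv> pair_span (\<lambda>l. l \<in> strict_partitions)"

lemma strict_span_vertex_word: "strict_span (vertex_word l) (word_form l)"
proof (induction l)
  case Nil
  have "[] \<in> strict_partitions" by (simp add: strict_partitions_iff)
  then show ?case by (rule pair_span_base)
next
  case (Cons p l)
  have "strict_span (vertex p (vertex_word l)) (\<lambda>H. word_form l (vertex_adj p H))"
  proof (rule pair_span_vertex[OF Cons])
    fix l' assume "l' \<in> strict_partitions"
    then obtain m where "m \<ge> p + 1" "strict_below m l'"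
      using strict_partitions_below by blast
    then have "pair_span (strict_below m) (vertex p (vertex_word l'))
      (\<lambda>H. word_form l' (vertex_adj p H))"
      by (intro pair_span_vertex_strict_below) auto
    then show "strict_span (vertex p (vertex_word l')) (\<lambda>H. word_form l' (vertex_adj p H))"
      by (rule pair_span_trans) (simp add: pair_span_base strict_below_imp)
  qed
  then show ?case by simp
qed

lemma strict_span_vertex: "strict_span F \<beta> \<Longrightarrow> strict_span (vertex p F) (\<lambda>H. \<beta> (vertex_adj p H))"
  by (erule pair_span_vertex) (use strict_span_vertex_word[of "p # _"] in \<open>simp add: word_form_Cons\<close>)

text \<open>Multiplication by \<open>q s\<close> and composition with \<open>qperp s\<close> follow
  the parallel recurrences \<open>vertex_q_mult\<close> and \<open>vertex_adj_qperp\<close>.\<close>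

lemma strict_span_q_vertex_word: "strict_span (q s * vertex_word l) (\<lambda>H. word_form l (qperp s H))"
proof (induction l arbitrary: s)
  case Nil
  show ?case
    by (rule pair_span_cong[of _ _ "word_form [s]"])
       (use strict_span_vertex_word[of "[s]"] in \<open>auto simp: vertex_1 vertex_adj_def
         icoeff_alt_sign_mult icoeff_vertex\<close>)
next
  case (Cons p l)
  show ?case
  \<comment> \<open>Lowering \<open>s\<close> raises the first letter, so \<open>p\<close> has to
    vary; for \<open>s < 0\<close> both components are 0.\<close>
  proof (induction "nat (s + 1)" arbitrary: s p rule: less_induct)
    case less
    show ?case
    proof (cases "s < 0")
      case True
      show ?thesis by (rule pair_span_cong[of _ _ "\<lambda>_. 0"]) (use True in \<open>auto simp: pair_span_0\<close>)
    next
      case False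
      have "strict_span (q (s - 1) * vertex_word ((p + 1) # l))
        (\<lambda>H. word_form ((p + 1) # l) (qperp (s - 1) H))"
        by (rule less) (use False in simp)
      from pair_span_add[OF this pair_span_add[OF strict_span_vertex[OF Cons, of p s]
            strict_span_vertex[OF Cons, of "p + 1" "s - 1"]]]
      have "strict_span (q (s - 1) * vertex (p + 1) (vertex_word l) +
          (vertex p (q s * vertex_word l) + vertex (p + 1) (q (s - 1) * vertex_word l)))
        (\<lambda>H. word_form l (vertex_adj (p + 1) (qperp (s - 1) H))
          + (word_form l (qperp s (vertex_adj p H))
            + word_form l (qperp (s - 1) (vertex_adj (p + 1) H))))"
        by simp
      also have "q (s - 1) * vertex (p + 1) (vertex_word l)
        + (vertex p (q s * vertex_word l) + vertex (p + 1) (q (s - 1) * vertex_word l))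
        = q s * vertex_word (p # l)"
        by (simp add: vertex_q_mult)
      finally show ?thesis
      proof (rule pair_span_cong)
        fix H assume "H \<in> Gamma"
        then show "word_form (p # l) (qperp s H) = word_form l (vertex_adj (p + 1) (qperp (s - 1) H))
          + (word_form l (qperp s (vertex_adj p H))
            + word_form l (qperp (s - 1) (vertex_adj (p + 1) H)))"
          by (simp add: vertex_adj_qperp[of H p s] word_form_add Gamma_add)
      qed
    qed
  qed
qed

lemma strict_span_q:
  assumes "strict_span F \<beta>"
  shows "strict_span (q s * F) (\<lambda>H. \<beta> (qperp s H))"
  using assms
proof (induction rule: pair_span.induct)
  case pair_span_0
  show ?case by (simp add: pair_span.pair_span_0)
next
  case (pair_span_base l)
  then show ?case by (intro strict_span_q_vertex_word)
next
  case (pair_span_add F \<beta> G \<gamma>)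
  then show ?case by (simp add: distrib_left pair_span.pair_span_add)
next
  case (pair_span_uminus F \<beta>)
  then show ?case by (simp add: pair_span.pair_span_uminus)
next
  case (pair_span_cong F \<beta> \<gamma>)
  show ?case by (rule pair_span.pair_span_cong[OF pair_span_cong.IH]) (simp add: pair_span_cong)
qed

lemma strict_span_exists: "F \<in> Gamma \<Longrightarrow> \<exists>\<beta>. strict_span F \<beta>"
proof (induction F rule: Gamma_q_induct)
  case one
  show ?case using strict_span_vertex_word[of "[]"] by auto
qed (auto intro: pair_span_add pair_span_uminus strict_span_q)

lemma pair_span_expansion:
  assumes "pair_span P F \<beta>"
  shows "\<exists>a. finite {l. a l \<noteq> 0} \<and> {l. a l \<noteq> 0} \<subseteq> Collect P
    \<and> F = (\<Sum>l | a l \<noteq> 0. of_int (a l) * vertex_word l)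
    \<and> (\<forall>H\<in>Gamma. \<beta> H = (\<Sum>l | a l \<noteq> 0. a l * word_form l H))"
  using assms
proof (induction rule: pair_span.induct)
  case pair_span_0
  show ?case by (rule exI[of _ "\<lambda>_. 0"]) auto
next
  case (pair_span_base l)
  then show ?case by (intro exI[of _ "\<lambda>l'. if l' = l then 1 else 0"]) auto
next
  case (pair_span_add F \<beta> G \<gamma>)
  then obtain a b where a: "finite {l. a l \<noteq> 0}" "{l. a l \<noteq> 0} \<subseteq> Collect P"
      "F = (\<Sum>l | a l \<noteq> 0. of_int (a l) * vertex_word l)"
      "\<And>H. H \<in> Gamma \<Longrightarrow> \<beta> H = (\<Sum>l | a l \<noteq> 0. a l * word_form l H)"
    and b: "finite {l. b l \<noteq> 0}" "{l. b l \<noteq> 0} \<subseteq> Collect P"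
      "G = (\<Sum>l | b l \<noteq> 0. of_int (b l) * vertex_word l)"
      "\<And>H. H \<in> Gamma \<Longrightarrow> \<gamma> H = (\<Sum>l | b l \<noteq> 0. b l * word_form l H)" by (elim exE conjE) blast
  let ?A = "{l. a l \<noteq> 0} \<union> {l. b l \<noteq> 0}"
  have A: "finite ?A" "?A \<subseteq> Collect P" using a b by auto
  have sub: "{l. a l + b l \<noteq> 0} \<subseteq> ?A" by auto
  have ext: "(\<Sum>l | c l \<noteq> 0. of_int (c l) * f l) = (\<Sum>l\<in>?A. of_int (c l) * f l)"
    if "{l. c l \<noteq> 0} \<subseteq> ?A" for c and f :: "int list \<Rightarrow> 'a :: comm_ring_1"
    using that by (intro sum.mono_neutral_left A) auto
  have "F + G = (\<Sum>l | a l + b l \<noteq> 0. of_int (a l + b l) * vertex_word l)"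
    unfolding a(3) b(3) by (subst (1 2 3) ext) (auto simp: distrib_right sum.distrib)
  moreover have "\<beta> H + \<gamma> H = (\<Sum>l | a l + b l \<noteq> 0. (a l + b l) * word_form l H)" if "H \<in> Gamma" for H
    using ext[of a "\<lambda>l. word_form l H"] ext[of b "\<lambda>l. word_form l H"] ext[OF sub, of
      "\<lambda>l. word_form l H"] that
    by (simp add: a(4) b(4) distrib_right sum.distrib)
  ultimately show ?case
    using finite_subset[OF sub A(1)] sub A(2) by (intro exI[of _ "\<lambda>l. a l + b l"]) blast
next
  case (pair_span_uminus F \<beta>)
  then obtain a where "finite {l. a l \<noteq> 0}" "{l. a l \<noteq> 0} \<subseteq> Collect P"
      "F = (\<Sum>l | a l \<noteq> 0. of_int (a l) * vertex_word l)"
      "\<And>H. H \<in> Gamma \<Longrightarrow> \<beta> H = (\<Sum>l | a l \<noteq> 0. a l * word_form l H)" by (elim exE conjE) blast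
  then show ?case by (intro exI[of _ "\<lambda>l. - a l"]) (auto simp: sum_negf)
next
  case (pair_span_cong F \<beta> \<gamma>)
  then obtain a where "finite {l. a l \<noteq> 0} \<and> {l. a l \<noteq> 0} \<subseteq> Collect P
      \<and> F = (\<Sum>l | a l \<noteq> 0. of_int (a l) * vertex_word l)"
    "\<forall>H\<in>Gamma. \<beta> H = (\<Sum>l | a l \<noteq> 0. a l * word_form l H)" by blast
  then show ?case using pair_span_cong(2) by (intro exI[of _ a]) simp
qed

section \<open>Coordinates, the inner product and adjoints\<close>

definition Qexpansion :: "ipser \<Rightarrow> (int list \<Rightarrow> int) \<Rightarrow> bool" where
  "Qexpansion F c \<longleftrightarrow> finite {l. c l \<noteq> 0} \<and> {l. c l \<noteq> 0} \<subseteq> strict_partitions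
    \<and> F = (\<Sum>l | c l \<noteq> 0. of_int (c l) * Qfun l)"

text \<open>By orthogonality the functionals read off coordinates, which makes them unique and
  justifies the description operator in \<open>Qcoord\<close>.\<close>

lemma word_form_Qexpansion:
  assumes "Qexpansion F c" "l \<in> strict_partitions"
  shows "word_form l F = 2 ^ length l * c l"
proof -
  have c: "finite {l. c l \<noteq> 0}" "{l. c l \<noteq> 0} \<subseteq> strict_partitions"
    "F = (\<Sum>l | c l \<noteq> 0. of_int (c l) * vertex_word l)"
    using assms(1) by (auto simp: Qexpansion_def Qfun_eq_vertex_word)
  have "word_form l F = (\<Sum>l' | c l' \<noteq> 0. c l' * word_form l (vertex_word l'))"
    unfolding c(3) by (simp add: word_form_sum word_form_of_int_mult Gamma_mult Gamma_of_int)
  also have "\<dots> = (\<Sum>l' | c l' \<noteq> 0. if l' = l then 2 ^ length l * c l else 0)"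
    using c(2) assms(2) by (intro sum.cong refl) (auto simp: word_form_vertex_word)
  also have "\<dots> = 2 ^ length l * c l"
    using c(1) by (simp add: sum.delta)
  finally show ?thesis .
qed

lemma Qexpansion_outside: "Qexpansion F c \<Longrightarrow> l \<notin> strict_partitions \<Longrightarrow> c l = 0"
  unfolding Qexpansion_def by blast

lemma Qcoord_eq:
  assumes "Qexpansion F c"
  shows "Qcoord F = c"
proof -
  have "c' = c" if "Qexpansion F c'" for c'
  proof
    fix l
    show "c' l = c l"
      using word_form_Qexpansion[OF that, of l] word_form_Qexpansion[OF assms, of l] assms that
      by (cases "l \<in> strict_partitions") (auto simp: Qexpansion_outside)
  qed
  then show ?thesis
    unfolding Qcoord_def Qexpansion_def[symmetric] using assms by (intro the_equality)
qed

lemma Qexpansion_exists: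
  assumes "F \<in> Gamma"
  obtains c where "Qexpansion F c"
proof -
  obtain \<beta> where "strict_span F \<beta>" using strict_span_exists[OF assms] ..
  from pair_span_expansion[OF this] show thesis
    using that by (auto simp: Qexpansion_def Qfun_eq_vertex_word)
qed

text \<open>Expanding \<open>F\<close> turns \<beta> into a combination of the
  \<open>word_form l\<close>, and these read off the coordinates of \<open>G\<close>. From here on
  \<open>Qinner\<close> can be computed with functionals.\<close>

lemma Qinner_eq:
  assumes "strict_span F \<beta>" "G \<in> Gamma"
  shows "Qinner F G = \<beta> G"
proof -
  from pair_span_expansion[OF assms(1)] obtain a where
    a: "Qexpansion F a" "\<beta> G = (\<Sum>l | a l \<noteq> 0. a l * word_form l G)"
    using assms(2) by (auto simp: Qexpansion_def Qfun_eq_vertex_word)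
  obtain b where b: "Qexpansion G b" using Qexpansion_exists[OF assms(2)] .
  have fin: "finite {l. a l \<noteq> 0}" "{l. a l \<noteq> 0} \<subseteq> strict_partitions"
    using a by (auto simp: Qexpansion_def)
  have "\<beta> G = (\<Sum>l | a l \<noteq> 0. 2 ^ len l * a l * b l)"
    unfolding a(2)
  proof (intro sum.cong refl)
    fix l assume "l \<in> {l. a l \<noteq> 0}"
    then have l: "l \<in> strict_partitions" using fin by auto
    then have "len l = length l"
      by (auto simp: strict_partitions_def len_def intro!: arg_cong[of _ _ length] filter_True)
    then show "a l * word_form l G = 2 ^ len l * a l * b l"
      using word_form_Qexpansion[OF b l] by simp
  qed
  also have "\<dots> = (\<Sum>l | a l \<noteq> 0 \<and> b l \<noteq> 0. 2 ^ len l * a l * b l)"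
    using fin(1) by (intro sum.mono_neutral_right) auto
  finally show ?thesis by (simp add: Qinner_def Qcoord_eq[OF a(1)] Qcoord_eq[OF b])
qed

lemma Qinner_commute: "Qinner F G = Qinner G F"
  by (simp add: Qinner_def conj_commute ac_simps)

lemma Qinner_q_mult:
  assumes "F \<in> Gamma" "G \<in> Gamma"
  shows "Qinner (q n * F) G = Qinner F (qperp n G)"
proof -
  obtain \<beta> where "strict_span F \<beta>" using strict_span_exists[OF assms(1)] ..
  then show ?thesis
    using assms by (simp add: Qinner_eq[OF strict_span_q] Qinner_eq)
qed

lemma Qinner_uminus: "F \<in> Gamma \<Longrightarrow> G \<in> Gamma \<Longrightarrow> Qinner (- F) G = - Qinner F G"
  using strict_span_exists[of F] Qinner_eq pair_span_uminus by metis

lemma Qinner_alt_sign_mult: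
  assumes "F \<in> Gamma" "G \<in> Gamma"
  shows "Qinner (alt_sign n * F) G = Qinner F (alt_sign n * G)"
  using assms by (simp add: alt_sign_def Qinner_uminus Qinner_commute[of F
    "- G"] Qinner_commute[of G F])

lemma Qinner_nondegenerate:
  assumes "K \<in> Gamma" "K' \<in> Gamma" "\<And>G. G \<in> Gamma \<Longrightarrow> Qinner G K = Qinner G K'"
  shows "K = K'"
proof -
  obtain c c' where c: "Qexpansion K c" "Qexpansion K' c'"
    using Qexpansion_exists assms by metis
  have "c l = c' l" for l
  proof (cases "l \<in> strict_partitions")
    case True
    have "word_form l K = word_form l K'"
      using assms(3)[OF vertex_word_Gamma, of l] Qinner_eq[OF strict_span_vertex_word assms(1), of l]
        Qinner_eq[OF strict_span_vertex_word assms(2), of l] by simp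
    then show ?thesis using word_form_Qexpansion[OF c(1) True] word_form_Qexpansion[OF c(2) True]
      by simp
  next
    case False
    then show ?thesis using c by (auto simp: Qexpansion_outside)
  qed
  then have "c = c'" ..
  then show ?thesis using c by (simp add: Qexpansion_def)
qed

text \<open>\<open>Qinner_q_mult\<close> gives existence and \<open>Qinner_nondegenerate\<close>
  uniqueness of the adjoint. The sign is included because \<open>alt_sign n * q n\<close> is a
  coefficient of the series at \<open>-1/z\<close>.\<close>

lemma perp_q:
  assumes "H \<in> Gamma"
  shows "perp (alt_sign n * q n) H = alt_sign n * qperp n H"
  unfolding perp_def
proof (rule the_equality)
  have *: "alt_sign n * qperp n H \<in> Gamma" using assms by (intro Gamma_mult) auto
  have **: "Qinner (alt_sign n * q n * G) H = Qinner G (alt_sign n * qperp n H)" if "G \<in> Gamma" for G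
    using that assms by (simp add: mult.assoc Qinner_alt_sign_mult Qinner_q_mult Gamma_mult
      qperp_alt_sign_mult)
  show "alt_sign n * qperp n H \<in> Gamma \<and> (\<forall>G\<in>Gamma. Qinner (alt_sign n * q n * G) H
    = Qinner G (alt_sign n * qperp n H))"
    using * ** by blast
  fix K assume "K \<in> Gamma \<and> (\<forall>G\<in>Gamma. Qinner (alt_sign n * q n * G) H = Qinner G K)"
  then show "K = alt_sign n * qperp n H"
    using * ** by (intro Qinner_nondegenerate) auto
qed

theorem theorem4p3:
  fixes lam :: "int list"
  assumes "is_partition lam"
  shows "(\<lambda>p. Qfun (p # lam)) = series_mult kappa_z (series_perp kappa_minus_inv_z (Qfun lam))"
proof
  fix p
  have perp: "series_perp kappa_minus_inv_z (vertex_word lam) k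
    = alt_sign k * qperp (- k) (vertex_word lam)" for k
    using perp_q[of "vertex_word lam" "- k"]
    by (simp add: series_perp_def kappa_minus_inv_z_def alt_sign_def split: if_splits)
  have "vertex p (vertex_word lam)
    = Sum_any (\<lambda>m. q m * (alt_sign (p - m) * qperp (- (p - m)) (vertex_word lam)))"
    unfolding vertex_def
  \<comment> \<open>The series product sums over the index of \<open>q\<close>, whereas
    \<open>vertex\<close> sums over the index of \<open>qperp\<close>; they differ by
    \<open>p\<close>.\<close>
  proof (rule Sum_any.reindex_cong[symmetric])
    show "bij ((+) p)" by simp
    show "(\<lambda>m. q m * (alt_sign (p - m) * qperp (- (p - m)) (vertex_word lam))) \<circ> (+) p
      = (\<lambda>m. alt_sign m * q (p + m) * qperp m (vertex_word lam))"
      by (auto simp: fun_eq_iff mult.left_commute mult.assoc)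
  qed
  then show "Qfun (p # lam) = series_mult kappa_z (series_perp kappa_minus_inv_z (Qfun lam)) p"
    by (simp add: Qfun_eq_vertex_word series_mult_def kappa_z_def perp)
qed

end
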